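(* Let $n\ge1$ and let $P$ be a simple $D_n$-module. Then: (1) The $\mathfrak g_n$-module $T(P,V(\delta_r,r))/\tilde L_n(P,r)$ is simple for $0\le r\le n-1$. (2) $L_n(P,r)$ is a simple $\mathfrak g_n$-module for $1\le r\le n$; moreover $T(P,V(\delta_{r-1},r-1))/\tilde L_n(P,r-1)\cong L_n(P,r)$ as $\mathfrak g_n$-modules. (3) The $\mathfrak g_n$-module $T(P,V(\delta_0,0))=P$ is simple if and only if $P\not\cong A_n$ (as $D_n$-modules). Moreover, the $\mathfrak g_n$-module $A_n/\mathbb C\cdot 1$ is simple. (4) The $\mathfrak g_n$-module $T(P,V(\delta_n,n))$ is simple if and only if $\sum_{i=1}^n d_iP=P$. If it is reducible, then $T(P,V(\delta_n,n))/L_n(P,n)$ is a trivial $\mathfrak g_n$-module.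
   Context: All vector spaces and algebras are over $\mathbb C$, and $\otimes=\otimes_{\mathbb C}$. For a positive integer $n$, $A_n=\mathbb C[t_1^{\pm1},\ldots,t_n^{\pm1},x_1,\ldots,x_n]$, $d_i=t_i\frac{\partial}{\partial t_i}+\frac{\partial}{\partial x_i}$, and $\mathfrak g_n=\bigoplus_{i=1}^nA_nd_i$, a Lie subalgebra of $\mathrm{Der}(A_n)$. $D_n$ is the associative algebra generated by the commutative algebra $A_n$ and commuting elements $d_1,\ldots,d_n$ subject to $d_if-fd_i=d_i(f)$ for $f\in A_n$. $A_n$ is a $D_n$-module (and a $\mathfrak g_n$-module) in the natural way. $E_{i,j}$ denotes the $n\times n$ matrix unit. For a $D_n$-module $P$ and a $\mathfrak{gl}_n$-module $V$, $T(P,V)=P\otimes V$ is the $\mathfrak g_n$-module with action $$(fd_j)(p\otimes v)=(fd_jp)\otimes v+\sum_{i=1}^n d_i(f)p\otimes E_{i,j}v,\qquad f\in A_n,\ 1\le j\le n.$$ For $0\le r\le n$, $V(\delta_r,r)=\bigwedge^r(\mathbb C^n)$ denotes the $r$-th exterior power of the natural $\mathfrak{gl}_n$-module $\mathbb C^n$ with standard basis $e_1,\ldots,e_n$ (with $V(\delta_0,0)$ the trivial one-dimensional module, so $T(P,V(\delta_0,0))=P$ with $fd_j$ acting as the element $fd_j\in D_n$). For $0\le k\le n-1$ let $\pi_k:T(P,V(\delta_k,k))\to T(P,V(\delta_{k+1},k+1))$ be the $\mathfrak g_n$-module homomorphism $\pi_k(p\otimes v)=\sum_{i=1}^n d_ip\otimes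 e_i\wedge v$. Set $L_n(P,0)=0$ and $L_n(P,r)=\pi_{r-1}(T(P,V(\delta_{r-1},r-1)))$ for $1\le r\le n$, and for $0\le r\le n$ set $$\tilde L_n(P,r)=\{u\in T(P,V(\delta_r,r))\mid \mathfrak g_nu\subseteq L_n(P,r)\}.$$ *)

theory Defs
  imports
    "HOL-Library.Poly_Mapping"
    "HOL-Library.Product_Plus"
    "HOL-Library.Cardinality"
    "HOL-Algebra.Module"
    "HOL-Algebra.AbelCoset"
    "HOL-Algebra.Algebraic_Closure_Type"
begin

section \<open>The algebra \<open>A\<^sub>n\<close> and its derivations\<close>

text \<open>
  The number of variables is the cardinality of the index type \<open>'n\<close>.  The algebra \<open>A\<^sub>n\<close> is the
  monoid algebra over the complex numbers of the monoid of exponents: the key \<open>(a, b)\<close> stands for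
  the monomial \<open>t^a x^b\<close> with \<open>a\<close> an integer and \<open>b\<close> a natural exponent vector.
\<close>

type_synonym 'n expo = "('n \<Rightarrow>\<^sub>0 int) \<times> ('n \<Rightarrow>\<^sub>0 nat)"
type_synonym 'n An = "'n expo \<Rightarrow>\<^sub>0 complex"

definition cst :: "complex \<Rightarrow> 'n An" where
  "cst c = Poly_Mapping.single 0 c"

definition t_ddt :: "'n \<Rightarrow> 'n An \<Rightarrow> 'n An" where
  "t_ddt i f = (\<Sum>(a, b)\<in>Poly_Mapping.keys f.
     Poly_Mapping.single (a, b) (of_int (Poly_Mapping.lookup a i) * Poly_Mapping.lookup f (a, b)))"

text \<open>If the exponent of \<open>x\<^sub>i\<close> is \<open>0\<close>, then the subtraction of exponents is truncated, but the
  coefficient is \<open>0\<close>.\<close>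

definition ddx :: "'n \<Rightarrow> 'n An \<Rightarrow> 'n An" where
  "ddx i f = (\<Sum>(a, b)\<in>Poly_Mapping.keys f.
     Poly_Mapping.single (a, b - Poly_Mapping.single i 1)
       (of_nat (Poly_Mapping.lookup b i) * Poly_Mapping.lookup f (a, b)))"

definition dA :: "'n \<Rightarrow> 'n An \<Rightarrow> 'n An" where
  "dA i f = t_ddt i f + ddx i f"

section \<open>Modules over \<open>D\<^sub>n\<close>\<close>

text \<open>
  A module over the algebra \<open>D\<^sub>n\<close>, which is given by generators and relations, is an
  \<open>A\<^sub>n\<close>-module together with operators \<open>d\<^sub>i\<close> satisfying the relations.  Its complex vector
  space structure is the one given by the constants of \<open>A\<^sub>n\<close>; the \<open>d\<^sub>i\<close> are then linear by
  the Leibniz relation.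
\<close>

locale D_module = Modules.module sm
  for sm :: "'n::finite An \<Rightarrow> 'p::ab_group_add \<Rightarrow> 'p" +
  fixes d :: "'n \<Rightarrow> 'p \<Rightarrow> 'p"
  assumes d_add: "d i (p + q) = d i p + d i q"
    and d_commute: "d i (d j p) = d j (d i p)"
    and d_Leibniz: "d i (sm f p) - sm f (d i p) = sm (dA i f) p"

definition D_submodule ::
  "('n::finite An \<Rightarrow> 'p::ab_group_add \<Rightarrow> 'p) \<Rightarrow> ('n \<Rightarrow> 'p \<Rightarrow> 'p) \<Rightarrow> 'p set \<Rightarrow> bool" where
  "D_submodule sm d S \<longleftrightarrow> module.subspace sm S \<and> (\<forall>i. \<forall>p\<in>S. d i p \<in> S)"

definition simple_D_module ::
  "('n::finite An \<Rightarrow> 'p::ab_group_add \<Rightarrow> 'p) \<Rightarrow> ('n \<Rightarrow> 'p \<Rightarrow> 'p) \<Rightarrow> bool" where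
  "simple_D_module sm d \<longleftrightarrow> D_module sm d \<and> (UNIV :: 'p set) \<noteq> {0} \<and>
     (\<forall>S. D_submodule sm d S \<longrightarrow> S = {0} \<or> S = UNIV)"

definition D_isomorphic ::
  "('n::finite An \<Rightarrow> 'p::ab_group_add \<Rightarrow> 'p) \<Rightarrow> ('n \<Rightarrow> 'p \<Rightarrow> 'p) \<Rightarrow>
   ('n An \<Rightarrow> 'q::ab_group_add \<Rightarrow> 'q) \<Rightarrow> ('n \<Rightarrow> 'q \<Rightarrow> 'q) \<Rightarrow> bool" where
  "D_isomorphic sm d sm' d' \<longleftrightarrow>
     (\<exists>\<phi>. bij \<phi> \<and> (\<forall>p q. \<phi> (p + q) = \<phi> p + \<phi> q) \<and> (\<forall>f p. \<phi> (sm f p) = sm' f (\<phi> p)) \<and>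
          (\<forall>i p. \<phi> (d i p) = d' i (\<phi> p)))"

section \<open>The Lie algebra \<open>\<g>\<^sub>n\<close> and its modules\<close>

text \<open>An element \<open>\<xi>\<close> of \<open>\<g>\<^sub>n\<close> is given by its coordinates: it is the sum of the \<open>\<xi> j d\<^sub>j\<close>.\<close>

type_synonym 'n gn = "'n \<Rightarrow> 'n An"

definition gn_derivation :: "'n::finite gn \<Rightarrow> 'n An \<Rightarrow> 'n An" where
  "gn_derivation \<xi> f = (\<Sum>j\<in>UNIV. \<xi> j * dA j f)"

definition gn_bracket :: "'n::finite gn \<Rightarrow> 'n gn \<Rightarrow> 'n gn" where
  "gn_bracket \<xi> \<eta> = (\<lambda>j. gn_derivation \<xi> (\<eta> j) - gn_derivation \<eta> (\<xi> j))"

abbreviation complex_ring :: "complex ring" where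
  "complex_ring \<equiv> ring_of_type_algebra"

text \<open>The fields \<open>mult\<close> and \<open>one\<close> inherited from \<open>ring\<close> play no role for modules.\<close>

record ('n, 'm) gn_rep = "(complex, 'm) module" +
  act :: "'n gn \<Rightarrow> 'm \<Rightarrow> 'm"

locale gn_module = Module.module complex_ring M
  for M :: "('n::finite, 'm) gn_rep" (structure) +
  assumes act_closed: "u \<in> carrier M \<Longrightarrow> act M \<xi> u \<in> carrier M"
    and act_add: "u \<in> carrier M \<Longrightarrow> v \<in> carrier M \<Longrightarrow>
      act M \<xi> (u \<oplus> v) = act M \<xi> u \<oplus> act M \<xi> v"
    and act_smult: "u \<in> carrier M \<Longrightarrow> act M \<xi> (c \<odot> u) = c \<odot> act M \<xi> u"
    and add_act: "u \<in> carrier M \<Longrightarrow> act M (\<lambda>j. \<xi> j + \<eta> j) u = act M \<xi> u \<oplus> act M \<eta> u"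
    and smult_act: "u \<in> carrier M \<Longrightarrow> act M (\<lambda>j. cst c * \<xi> j) u = c \<odot> act M \<xi> u"
    and bracket_act: "u \<in> carrier M \<Longrightarrow>
      act M (gn_bracket \<xi> \<eta>) u = act M \<xi> (act M \<eta> u) \<ominus> act M \<eta> (act M \<xi> u)"

definition gn_submodule :: "'m set \<Rightarrow> ('n, 'm) gn_rep \<Rightarrow> bool" where
  "gn_submodule N M \<longleftrightarrow> submodule N complex_ring M \<and> (\<forall>\<xi>. \<forall>u\<in>N. act M \<xi> u \<in> N)"

definition simple_gn_module :: "('n::finite, 'm) gn_rep \<Rightarrow> bool" where
  "simple_gn_module M \<longleftrightarrow> gn_module M \<and> carrier M \<noteq> {\<zero>\<^bsub>M\<^esub>} \<and>
     (\<forall>N. gn_submodule N M \<longrightarrow> N = {\<zero>\<^bsub>M\<^esub>} \<or> N = carrier M)"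

definition trivial_gn_module :: "('n::finite, 'm) gn_rep \<Rightarrow> bool" where
  "trivial_gn_module M \<longleftrightarrow> gn_module M \<and> (\<forall>\<xi>. \<forall>u\<in>carrier M. act M \<xi> u = \<zero>\<^bsub>M\<^esub>)"

definition gn_isomorphic :: "('n::finite, 'm) gn_rep \<Rightarrow> ('n, 'k) gn_rep \<Rightarrow> bool" where
  "gn_isomorphic M N \<longleftrightarrow> gn_module M \<and> gn_module N \<and>
     (\<exists>\<phi>. bij_betw \<phi> (carrier M) (carrier N) \<and>
          (\<forall>u\<in>carrier M. \<forall>v\<in>carrier M. \<phi> (u \<oplus>\<^bsub>M\<^esub> v) = \<phi> u \<oplus>\<^bsub>N\<^esub> \<phi> v) \<and>
          (\<forall>c. \<forall>u\<in>carrier M. \<phi> (c \<odot>\<^bsub>M\<^esub> u) = c \<odot>\<^bsub>N\<^esub> \<phi> u) \<and>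
          (\<forall>\<xi>. \<forall>u\<in>carrier M. \<phi> (act M \<xi> u) = act N \<xi> (\<phi> u)))"

definition gn_sub :: "('n, 'm) gn_rep \<Rightarrow> 'm set \<Rightarrow> ('n, 'm) gn_rep" where
  "gn_sub M N = M\<lparr>carrier := N\<rparr>"

definition gn_quot :: "('n, 'm) gn_rep \<Rightarrow> 'm set \<Rightarrow> ('n, 'm set) gn_rep" where
  "gn_quot M N = \<lparr>carrier = a_rcosets\<^bsub>M\<^esub> N, monoid.mult = undefined, one = undefined,
     zero = N, add = set_add M,
     module.smult = (\<lambda>c U. \<Union>u\<in>U. N +>\<^bsub>M\<^esub> (c \<odot>\<^bsub>M\<^esub> u)),
     act = (\<lambda>\<xi> U. \<Union>u\<in>U. N +>\<^bsub>M\<^esub> act M \<xi> u)\<rparr>"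

definition An_rep :: "('n::finite, 'n An) gn_rep" where
  "An_rep = \<lparr>carrier = UNIV, monoid.mult = undefined, one = undefined, zero = 0, add = (+),
     module.smult = (\<lambda>c f. cst c * f), act = gn_derivation\<rparr>"

section \<open>Exterior powers\<close>

text \<open>
  The \<open>r\<close>-th exterior power of \<open>\<complex>\<^sup>n\<close> has the basis \<open>e\<^sub>I\<close>, the product of the \<open>e\<^sub>i\<close> with \<open>i \<in> I\<close>
  in increasing order, where \<open>I\<close> ranges over the subsets of cardinality \<open>r\<close> of the index set.
  Hence the tensor product of a vector space \<open>P\<close> with it consists of the families \<open>u\<close> in \<open>P\<close>
  indexed by these subsets, \<open>u\<close> standing for the sum of the \<open>u I \<otimes> e\<^sub>I\<close>.  The operators
  below are written for such families with values in any group, so that they give both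
  an operator \<open>F\<close> on the exterior algebra and \<open>1 \<otimes> F\<close> on the tensor product.
\<close>

definition ext_power :: "nat \<Rightarrow> ('n::finite set \<Rightarrow> 'a::zero) set" where
  "ext_power r = {u. \<forall>I. card I \<noteq> r \<longrightarrow> u I = 0}"

definition ext_sign :: "'n::linorder \<Rightarrow> 'n set \<Rightarrow> 'a::ab_group_add \<Rightarrow> 'a" where
  "ext_sign i I p = (if even (card {k\<in>I. k < i}) then p else - p)"

definition ext_basis :: "'n set \<Rightarrow> 'n set \<Rightarrow> complex" where
  "ext_basis I = (\<lambda>J. if J = I then 1 else 0)"

text \<open>\<open>ext_wedge i\<close> is the left multiplication by \<open>e\<^sub>i\<close>, and \<open>ext_contract j\<close> is the contraction
  with the \<open>j\<close>-th vector of the dual basis.\<close>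

definition ext_wedge :: "'n::linorder \<Rightarrow> ('n set \<Rightarrow> 'a::ab_group_add) \<Rightarrow> 'n set \<Rightarrow> 'a" where
  "ext_wedge i u = (\<lambda>I. if i \<in> I then ext_sign i I (u (I - {i})) else 0)"

definition ext_contract :: "'n::linorder \<Rightarrow> ('n set \<Rightarrow> 'a::ab_group_add) \<Rightarrow> 'n set \<Rightarrow> 'a" where
  "ext_contract j u = (\<lambda>I. if j \<in> I then 0 else ext_sign j I (u (insert j I)))"

text \<open>The action of the matrix unit \<open>E\<^sub>i\<^sub>j\<close>, which is the derivation of the exterior algebra
  extending \<open>e\<^sub>k \<mapsto> \<delta>\<^sub>j\<^sub>k e\<^sub>i\<close>; see \<open>ext_E_empty\<close> and \<open>ext_E_wedge\<close> below.\<close>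

definition ext_E :: "'n::linorder \<Rightarrow> 'n \<Rightarrow> ('n set \<Rightarrow> 'a::ab_group_add) \<Rightarrow> 'n set \<Rightarrow> 'a" where
  "ext_E i j u = ext_wedge i (ext_contract j u)"

section \<open>The modules \<open>T(P, V(\<delta>\<^sub>r, r))\<close>\<close>

definition tensor :: "('n An \<Rightarrow> 'p \<Rightarrow> 'p) \<Rightarrow> 'p \<Rightarrow> ('n set \<Rightarrow> complex) \<Rightarrow> 'n set \<Rightarrow> 'p" where
  "tensor sm p v = (\<lambda>I. sm (cst (v I)) p)"

definition T_act ::
  "('n::{finite,linorder} An \<Rightarrow> 'p::ab_group_add \<Rightarrow> 'p) \<Rightarrow> ('n \<Rightarrow> 'p \<Rightarrow> 'p) \<Rightarrow>
   'n gn \<Rightarrow> ('n set \<Rightarrow> 'p) \<Rightarrow> 'n set \<Rightarrow> 'p" where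
  "T_act sm d \<xi> u = (\<lambda>I. \<Sum>j\<in>UNIV. (sm (\<xi> j) (d j (u I)) +
                           (\<Sum>i\<in>UNIV. sm (dA i (\<xi> j)) (ext_E i j u I))))"

definition T_rep ::
  "('n::{finite,linorder} An \<Rightarrow> 'p::ab_group_add \<Rightarrow> 'p) \<Rightarrow> ('n \<Rightarrow> 'p \<Rightarrow> 'p) \<Rightarrow> nat \<Rightarrow>
   ('n, 'n set \<Rightarrow> 'p) gn_rep" where
  "T_rep sm d r = \<lparr>carrier = ext_power r, monoid.mult = undefined, one = undefined,
     zero = (\<lambda>I. 0), add = (\<lambda>u v I. u I + v I),
     module.smult = (\<lambda>c u I. sm (cst c) (u I)), act = T_act sm d\<rparr>"

definition T_pi ::
  "('n::{finite,linorder} \<Rightarrow> 'p::ab_group_add \<Rightarrow> 'p) \<Rightarrow> ('n set \<Rightarrow> 'p) \<Rightarrow> 'n set \<Rightarrow> 'p" where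
  "T_pi d u = (\<lambda>I. \<Sum>i\<in>UNIV. ext_wedge i (\<lambda>J. d i (u J)) I)"

definition L_space ::
  "('n::{finite,linorder} \<Rightarrow> 'p::ab_group_add \<Rightarrow> 'p) \<Rightarrow> nat \<Rightarrow> ('n set \<Rightarrow> 'p) set" where
  "L_space d r = (if r = 0 then {\<lambda>I. 0} else T_pi d ` ext_power (r - 1))"

definition Lt_space ::
  "('n::{finite,linorder} An \<Rightarrow> 'p::ab_group_add \<Rightarrow> 'p) \<Rightarrow> ('n \<Rightarrow> 'p \<Rightarrow> 'p) \<Rightarrow> nat \<Rightarrow>
   ('n set \<Rightarrow> 'p) set" where
  "Lt_space sm d r = {u \<in> ext_power r. \<forall>\<xi>. T_act sm d \<xi> u \<in> L_space d r}"

definition L_rep ::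
  "('n::{finite,linorder} An \<Rightarrow> 'p::ab_group_add \<Rightarrow> 'p) \<Rightarrow> ('n \<Rightarrow> 'p \<Rightarrow> 'p) \<Rightarrow> nat \<Rightarrow>
   ('n, 'n set \<Rightarrow> 'p) gn_rep" where
  "L_rep sm d r = gn_sub (T_rep sm d r) (L_space d r)"

section \<open>Facts relating the encodings to the mathematics\<close>

text \<open>
  In particular: \<open>dA i\<close> is a derivation and \<open>A\<^sub>n\<close> is a \<open>D\<^sub>n\<close>-module; \<open>\<g>\<^sub>n\<close> embeds into the
  derivations of \<open>A\<^sub>n\<close> with the commutator as bracket; \<open>ext_wedge\<close> satisfies the relations of the
  exterior algebra and \<open>ext_E\<close> those of the matrix units; the formulas for the action and for
  \<open>T_pi\<close> on pure tensors are the usual ones (\<open>T_act_tensor\<close>, \<open>T_pi_tensor\<close>), and the pure tensors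
  span (\<open>tensor_expand\<close>); \<open>T_rep\<close> is a \<open>\<g>\<^sub>n\<close>-module.
\<close>


lemma An_induct [case_names add single]:
  fixes f :: "'n An"
  assumes "\<And>f g. P f \<Longrightarrow> P g \<Longrightarrow> P (f + g)" and s: "\<And>k c. P (Poly_Mapping.single k c)"
  shows "P f"
proof -
  have f: "f = (\<Sum>k\<in>Poly_Mapping.keys f. Poly_Mapping.single k (Poly_Mapping.lookup f k))"
    by (rule poly_mapping_eqI)
      (simp add: lookup_sum lookup_single when_def in_keys_iff)
  have "P (\<Sum>k\<in>A. Poly_Mapping.single k (Poly_Mapping.lookup f k))" if "finite A" for A
    using that by (induction A) (use s[of 0 0] in \<open>auto intro: assms\<close>)
  then show ?thesis using f by (metis finite_keys)
qed

lemma lookup_t_ddt: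
  "Poly_Mapping.lookup (t_ddt i f) (a, b) = of_int (Poly_Mapping.lookup a i) * Poly_Mapping.lookup f (a, b)"
proof -
  have "Poly_Mapping.lookup (t_ddt i f) (a, b) = (\<Sum>k\<in>Poly_Mapping.keys f.
     if k = (a, b) then of_int (Poly_Mapping.lookup a i) * Poly_Mapping.lookup f (a, b) else 0)"
    unfolding t_ddt_def lookup_sum
    by (intro sum.cong refl) (auto simp: lookup_single when_def split: prod.split)
  then show ?thesis by (simp add: in_keys_iff)
qed

lemma lookup_ddx:
  "Poly_Mapping.lookup (ddx i f) (a, b) =
     of_nat (Poly_Mapping.lookup b i + 1) * Poly_Mapping.lookup f (a, b + Poly_Mapping.single i 1)"
proof -
  have 1: "b' - Poly_Mapping.single i 1 = b \<and> Poly_Mapping.lookup b' i \<noteq> 0 \<longleftrightarrow> b' = b + Poly_Mapping.single i 1" for b' :: "'a \<Rightarrow>\<^sub>0 nat"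
    by (auto simp: poly_mapping_eq_iff fun_eq_iff lookup_minus lookup_add lookup_single when_def split: if_splits)
  have "Poly_Mapping.lookup (ddx i f) (a, b) = (\<Sum>k\<in>Poly_Mapping.keys f.
     if k = (a, b + Poly_Mapping.single i 1) then of_nat (Poly_Mapping.lookup b i + 1) * Poly_Mapping.lookup f (a, b + Poly_Mapping.single i 1) else 0)"
    unfolding ddx_def lookup_sum
  proof (intro sum.cong refl, clarify)
    fix a' b'
    show "Poly_Mapping.lookup (Poly_Mapping.single (a', b' - Poly_Mapping.single i 1)
       (of_nat (Poly_Mapping.lookup b' i) * Poly_Mapping.lookup f (a', b'))) (a, b) =
       (if (a', b') = (a, b + Poly_Mapping.single i 1) then of_nat (Poly_Mapping.lookup b i + 1) * Poly_Mapping.lookup f (a, b + Poly_Mapping.single i 1) else 0)"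
      using 1[of b'] by (cases "Poly_Mapping.lookup b' i = 0") (auto simp: lookup_single when_def lookup_add)
  qed
  then show ?thesis by (simp add: in_keys_iff)
qed

lemma dA_add: "dA i (f + g) = dA i f + dA i g"
  by (rule poly_mapping_eqI)
    (auto simp: dA_def lookup_add lookup_t_ddt lookup_ddx algebra_simps split_paired_all)

lemma dA_commute: "dA i (dA j f) = dA j (dA i f)"
proof (rule poly_mapping_eqI)
  fix k :: "'a expo"
  obtain a b where k: "k = (a, b)" by fastforce
  show "Poly_Mapping.lookup (dA i (dA j f)) k = Poly_Mapping.lookup (dA j (dA i f)) k"
    by (cases "i = j") (simp_all add: k dA_def lookup_add lookup_t_ddt lookup_ddx lookup_single algebra_simps)
qed

lemma dA_single: "dA i (Poly_Mapping.single (a, b) c) =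
   Poly_Mapping.single (a, b) (of_int (Poly_Mapping.lookup a i) * c) +
   Poly_Mapping.single (a, b - Poly_Mapping.single i 1) (of_nat (Poly_Mapping.lookup b i) * c)"
  by (cases "c = 0") (simp_all add: dA_def t_ddt_def ddx_def)

lemma dA_mult: "dA i (f * g) = dA i f * g + f * dA i g"
proof (induction f rule: An_induct)
  case (single k c)
  show ?case
  proof (induction g rule: An_induct)
    case (single l e)
    obtain a b where k: "k = (a, b)" by fastforce
    obtain a' b' where l: "l = (a', b')" by fastforce
    let ?s = "Poly_Mapping.single i (1::nat)"
    have 1: "(b + b') - ?s = (b - ?s) + b'" if "Poly_Mapping.lookup b i \<noteq> 0"
      using that by (auto simp: poly_mapping_eq_iff fun_eq_iff lookup_minus lookup_add lookup_single when_def)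
    have 2: "(b + b') - ?s = b + (b' - ?s)" if "Poly_Mapping.lookup b' i \<noteq> 0"
      using that by (auto simp: poly_mapping_eq_iff fun_eq_iff lookup_minus lookup_add lookup_single when_def)
    show ?case
      using 1 2
      apply (cases "Poly_Mapping.lookup b i = 0"; cases "Poly_Mapping.lookup b' i = 0")
      apply (simp_all add: k l mult_single dA_single lookup_add algebra_simps single_add)
      done
  qed (simp_all add: dA_add algebra_simps)
qed (simp_all add: dA_add algebra_simps)

lemma D_module_An: "D_module (*) (dA :: 'n::finite \<Rightarrow> _)"
  by unfold_locales (simp_all add: dA_add dA_mult dA_commute algebra_simps)

lemma gn_derivation_bracket:
  "gn_derivation (gn_bracket \<xi> \<eta>) f =
     gn_derivation \<xi> (gn_derivation \<eta> f) - gn_derivation \<eta> (gn_derivation \<xi> f)"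
proof -
  have s: "dA i (sum h A) = (\<Sum>j\<in>A. dA i (h j))" for i h and A :: "'a set"
  proof -
    have "dA i 0 = 0" using dA_add[of i 0 0] by simp
    then show ?thesis by (induction A rule: infinite_finite_induct) (simp_all add: dA_add)
  qed
  have 1: "gn_derivation \<xi> (gn_derivation \<eta> f) = (\<Sum>j\<in>UNIV. \<Sum>i\<in>UNIV. \<xi> i * dA i (\<eta> j) * dA j f) +
    (\<Sum>j\<in>UNIV. \<Sum>i\<in>UNIV. \<xi> i * \<eta> j * dA i (dA j f))" for \<xi> \<eta> 
    unfolding gn_derivation_def s sum_distrib_left
    apply (subst sum.swap)
    apply (simp add: dA_mult algebra_simps sum.distrib)
    done
  have "(\<Sum>j\<in>UNIV. \<Sum>i\<in>UNIV. \<xi> i * \<eta> j * dA i (dA j f)) = (\<Sum>j\<in>UNIV. \<Sum>i\<in>UNIV. \<eta> i * \<xi> j * dA i (dA j f))"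
    apply (subst sum.swap) by (simp add: dA_commute algebra_simps)
  then show ?thesis unfolding 1 
    by (simp add: gn_derivation_def gn_bracket_def sum_subtractf sum_distrib_right left_diff_distrib)
qed

lemma gn_derivation_inj:
  fixes \<xi> :: "'a::finite gn"
  shows "gn_derivation \<xi> = gn_derivation \<eta> \<Longrightarrow> \<xi> = \<eta>"
proof
  fix k :: 'a assume a: "gn_derivation \<xi> = gn_derivation \<eta>"
  let ?x = "Poly_Mapping.single (0, Poly_Mapping.single k 1) 1"
  have d: "dA j ?x = (if j = k then 1 else 0)" for j
    by (simp add: dA_single lookup_single when_def single_one flip: zero_prod_def)
  have "gn_derivation \<xi> ?x = \<xi> k" for \<xi>
    unfolding gn_derivation_def d by (simp add: if_distrib cong: if_cong)
  then show "\<xi> k = \<eta> k" using a by metis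
qed

lemma ext_sign_ext_sign: "ext_sign i I (ext_sign j J p) = ext_sign j J (ext_sign i I p)"
  by (simp add: ext_sign_def)

lemma ext_sign_insert:
  fixes I :: "'n::{finite,linorder} set"
  assumes "j \<notin> I"
  shows "ext_sign i (insert j I) p = (if j < i then - ext_sign i I p else ext_sign i I p)"
proof -
  have "{k\<in>insert j I. k < i} = (if j < i then insert j {k\<in>I. k < i} else {k\<in>I. k < i})" by auto
  then show ?thesis using assms by (simp add: ext_sign_def)
qed

lemma ext_sign_remove:
  fixes I :: "'n::{finite,linorder} set"
  assumes "j \<in> I"
  shows "ext_sign i (I - {j}) p = (if j < i then - ext_sign i I p else ext_sign i I p)"
  using ext_sign_insert[of j "I - {j}" i p] assms by (auto simp: insert_absorb)

lemma ext_sign_minus [simp]: "ext_sign i I (- p) = - ext_sign i I p"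
  and ext_sign_idem [simp]: "ext_sign i I (ext_sign i I p) = p"
  and ext_sign_0 [simp]: "ext_sign i I 0 = 0"
  by (simp_all add: ext_sign_def)

lemma ext_wedge_wedge:
  fixes u :: "'n::{finite,linorder} set \<Rightarrow> 'a::ab_group_add"
  shows "ext_wedge i (ext_wedge j u) I = - ext_wedge j (ext_wedge i u) I"
proof (cases "i \<noteq> j \<and> i \<in> I \<and> j \<in> I")
  case True
  have *: "ext_wedge i (ext_wedge j u) I =
      (if i < j then - ext_sign i I (ext_sign j I (u (I - {i} - {j})))
       else ext_sign i I (ext_sign j I (u (I - {i} - {j}))))"
    if "i \<noteq> j" "i \<in> I" "j \<in> I" for i j
    using that by (simp add: ext_wedge_def ext_sign_remove)
  have "I - {j} - {i} = I - {i} - {j}" by blast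
  then show ?thesis
    using True *[of i j] *[of j i] ext_sign_ext_sign[of j I i I "u (I - {i} - {j})"]
    by (metis add.inverse_inverse not_less_iff_gr_or_eq)
qed (auto simp: ext_wedge_def)

lemma ext_wedge_same: "ext_wedge i (ext_wedge i u) I = 0"
  by (simp add: ext_wedge_def)

lemma ext_contract_contract:
  fixes u :: "'n::{finite,linorder} set \<Rightarrow> 'a::ab_group_add"
  shows "ext_contract i (ext_contract j u) I = - ext_contract j (ext_contract i u) I"
proof (cases "i \<noteq> j \<and> i \<notin> I \<and> j \<notin> I")
  case True
  have *: "ext_contract i (ext_contract j u) I =
      (if i < j then - ext_sign i I (ext_sign j I (u (insert j (insert i I))))
       else ext_sign i I (ext_sign j I (u (insert j (insert i I)))))"
    if "i \<noteq> j" "i \<notin> I" "j \<notin> I" for i j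
    using that by (simp add: ext_contract_def ext_sign_insert)
  have "insert i (insert j I) = insert j (insert i I)" by blast
  then show ?thesis
    using True *[of i j] *[of j i] ext_sign_ext_sign[of j I i I "u (insert j (insert i I))"]
    by (metis add.inverse_inverse not_less_iff_gr_or_eq)
qed (auto simp: ext_contract_def)

lemma ext_contract_wedge:
  fixes u :: "'n::{finite,linorder} set \<Rightarrow> 'a::ab_group_add"
  shows "ext_contract j (ext_wedge i u) I + ext_wedge i (ext_contract j u) I = (if i = j then u I else 0)"
proof (cases "i = j")
  case True
  have "insert j I - {j} = I" if "j \<notin> I" using that by blast
  moreover have "insert j (I - {j}) = I" if "j \<in> I" using that by blast
  ultimately show ?thesis using True
    by (auto simp: ext_contract_def ext_wedge_def ext_sign_insert ext_sign_remove)
next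
  case False
  show ?thesis
  proof (cases "i \<in> I \<and> j \<notin> I")
    case True
    have 1: "insert j I - {i} = insert j (I - {i})" using False by blast
    have "ext_contract j (ext_wedge i u) I =
        ext_sign j I (ext_sign i (insert j I) (u (insert j (I - {i}))))"
      using True False 1 by (simp add: ext_contract_def ext_wedge_def)
    also have "\<dots> = (if j < i then - ext_sign j I (ext_sign i I (u (insert j (I - {i}))))
        else ext_sign j I (ext_sign i I (u (insert j (I - {i})))))"
      using True by (simp add: ext_sign_insert)
    finally have 2: "ext_contract j (ext_wedge i u) I =
        (if j < i then - ext_sign j I (ext_sign i I (u (insert j (I - {i}))))
         else ext_sign j I (ext_sign i I (u (insert j (I - {i})))))" .
    have 3: "ext_wedge i (ext_contract j u) I =
        (if i < j then - ext_sign i I (ext_sign j I (u (insert j (I - {i}))))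
         else ext_sign i I (ext_sign j I (u (insert j (I - {i})))))"
      using True by (simp add: ext_contract_def ext_wedge_def ext_sign_remove)
    show ?thesis
      using False ext_sign_ext_sign[of j I i I "u (insert j (I - {i}))"] unfolding 2 3 by auto
  qed (use False in \<open>auto simp: ext_contract_def ext_wedge_def\<close>)
qed

lemma ext_wedge_additive:
  assumes h: "\<And>p q. h (p + q) = h p + h q"
  shows "ext_wedge i (\<lambda>J. h (u J)) I = h (ext_wedge i u I)"
    and "ext_contract i (\<lambda>J. h (u J)) I = h (ext_contract i u I)"
    and "ext_E i j (\<lambda>J. h (u J)) I = h (ext_E i j u I)"
proof -
  have 0: "h 0 = 0" using h[of 0 0] by simp
  have m: "h (- p) = - h p" for p using h[of p "- p"] 0 by (simp add: eq_neg_iff_add_eq_0 add.commute)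
  show 1: "ext_wedge i (\<lambda>J. h (u J)) I = h (ext_wedge i u I)" for i u I
    by (simp add: ext_wedge_def ext_sign_def 0 m)
  show 2: "ext_contract i (\<lambda>J. h (u J)) I = h (ext_contract i u I)" for i I
    by (simp add: ext_contract_def ext_sign_def 0 m)
  have "ext_contract j (\<lambda>J. h (u J)) = (\<lambda>I. h (ext_contract j u I))" using 2 by blast
  then show "ext_E i j (\<lambda>J. h (u J)) I = h (ext_E i j u I)" by (simp add: ext_E_def 1)
qed

lemma ext_wedge_add: "ext_wedge i (\<lambda>J. u J + v J) I = ext_wedge i u I + ext_wedge i v I"
  and ext_contract_add: "ext_contract i (\<lambda>J. u J + v J) I = ext_contract i u I + ext_contract i v I"
  by (simp_all add: ext_wedge_def ext_contract_def ext_sign_def)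

lemma ext_wedge_diff: "ext_wedge i (\<lambda>J. u J - v J) I = ext_wedge i u I - ext_wedge i v I"
  by (simp add: ext_wedge_def ext_sign_def)

lemma ext_wedge_minus: "ext_wedge i (\<lambda>J. - u J) = (\<lambda>I. - ext_wedge i u I)"
  by (simp add: ext_wedge_def ext_sign_def fun_eq_iff)

lemma ext_wedge_0: "ext_wedge i (\<lambda>J. 0) I = 0" and ext_contract_0: "ext_contract i (\<lambda>J. 0) I = 0"
  by (simp_all add: ext_wedge_def ext_contract_def)

lemma ext_E_add: "ext_E i j (\<lambda>J. u J + v J) I = ext_E i j u I + ext_E i j v I"
proof -
  have "ext_contract j (\<lambda>J. u J + v J) = (\<lambda>J. ext_contract j u J + ext_contract j v J)"
    by (simp add: fun_eq_iff ext_contract_add)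
  then show ?thesis by (simp add: ext_E_def ext_wedge_add)
qed

lemma ext_E_0: "ext_E i j (\<lambda>J. 0) I = 0"
  using ext_E_add[of i j "\<lambda>J. 0" "\<lambda>J. 0" I] by simp

lemma ext_E_sum: "ext_E i j (\<lambda>J. \<Sum>k\<in>A. u k J) I = (\<Sum>k\<in>A. ext_E i j (u k) I)"
  by (induction A rule: infinite_finite_induct) (simp_all add: ext_E_0 ext_E_add)

lemma ext_E_wedge:
  fixes u :: "'n::{finite,linorder} set \<Rightarrow> 'a::ab_group_add"
  shows "ext_E i j (ext_wedge k u) I = (if j = k then ext_wedge i u I else 0) + ext_wedge k (ext_E i j u) I"
proof -
  have "ext_contract j (ext_wedge k u) = (\<lambda>I. (if j = k then u I else 0) - ext_wedge k (ext_contract j u) I)"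
    using ext_contract_wedge[of j k u] by (auto simp: fun_eq_iff eq_diff_eq)
  then have "ext_E i j (ext_wedge k u) I =
    ext_wedge i (\<lambda>I. if j = k then u I else 0) I - ext_wedge i (ext_wedge k (ext_contract j u)) I"
    unfolding ext_E_def by (simp only: ext_wedge_diff)
  then show ?thesis
    by (simp add: ext_E_def ext_wedge_wedge[of i k] ext_wedge_0)
qed

lemma ext_E_bracket:
  fixes u :: "'n::{finite,linorder} set \<Rightarrow> 'a::ab_group_add"
  shows "ext_E i j (ext_E k l u) I - ext_E k l (ext_E i j u) I =
    (if j = k then ext_E i l u I else 0) - (if l = i then ext_E k j u I else 0)"
proof -
  have 1: "ext_E i j (ext_E k l u) I = (if j = k then ext_E i l u I else 0)
    + ext_wedge k (ext_wedge i (ext_contract j (ext_contract l u))) I" for i j k l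
    using ext_E_wedge[of i j k "ext_contract l u" I] by (simp add: ext_E_def)
  have "ext_contract j (ext_contract l u) = (\<lambda>I. - ext_contract l (ext_contract j u) I)"
    by (simp add: fun_eq_iff ext_contract_contract[of j l])
  then have "ext_wedge k (ext_wedge i (ext_contract j (ext_contract l u))) I
     = - ext_wedge k (ext_wedge i (ext_contract l (ext_contract j u))) I"
    by (simp add: ext_wedge_minus)
  also have "\<dots> = ext_wedge i (ext_wedge k (ext_contract l (ext_contract j u))) I"
    by (simp add: ext_wedge_wedge[of i k])
  finally have "ext_wedge k (ext_wedge i (ext_contract j (ext_contract l u))) I
     = ext_wedge i (ext_wedge k (ext_contract l (ext_contract j u))) I" .
  then show ?thesis by (simp add: 1)
qed

lemma ext_E_empty: "ext_E i j (ext_basis {}) I = 0"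
  by (simp add: ext_E_def ext_wedge_def ext_contract_def ext_basis_def ext_sign_def)

lemma ext_wedge_basis:
  fixes i :: "'n::{finite,linorder}"
  assumes "\<And>k. k \<in> I \<Longrightarrow> i < k"
  shows "ext_wedge i (ext_basis I) = ext_basis (insert i I)"
proof
  fix J
  have i: "i \<notin> I" using assms by blast
  show "ext_wedge i (ext_basis I) J = ext_basis (insert i I) J"
  proof (cases "J = insert i I")
    case True
    have e: "{k \<in> insert i I. k < i} = {}" using assms by (auto dest: less_asym)
    have r: "insert i I - {i} = I" using i by blast
    show ?thesis
      unfolding True ext_wedge_def ext_basis_def ext_sign_def e r by simp
  next
    case False
    then have "i \<in> J \<Longrightarrow> J - {i} \<noteq> I" by blast
    then show ?thesis using False by (simp add: ext_wedge_def ext_basis_def ext_sign_def)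
  qed
qed

lemma ext_power_expand:
  fixes u :: "'n::finite set \<Rightarrow> complex"
  shows "u I = (\<Sum>J\<in>UNIV. u J * ext_basis J I)"
proof -
  have "(\<Sum>J\<in>UNIV. u J * ext_basis J I) = (\<Sum>J\<in>UNIV. if I = J then u J else 0)"
    by (rule sum.cong) (auto simp: ext_basis_def)
  then show ?thesis by simp
qed

lemma ext_wedge_power:
  fixes u :: "'n::{finite,linorder} set \<Rightarrow> 'a::ab_group_add"
  assumes "u \<in> ext_power r"
  shows "ext_wedge i u \<in> ext_power (Suc r)"
  unfolding ext_power_def
proof clarify
  fix I :: "'n set" assume I: "card I \<noteq> Suc r"
  show "ext_wedge i u I = 0"
  proof (cases "i \<in> I")
    case True
    then have "card (I - {i}) \<noteq> r" using I card_Suc_Diff1[of I i] by simp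
    then have "u (I - {i}) = 0" using assms by (simp add: ext_power_def)
    then show ?thesis by (simp add: ext_wedge_def)
  qed (simp add: ext_wedge_def)
qed

lemma ext_contract_power:
  fixes u :: "'n::{finite,linorder} set \<Rightarrow> 'a::ab_group_add"
  assumes "u \<in> ext_power (Suc r)"
  shows "ext_contract i u \<in> ext_power r"
  using assms by (simp add: ext_power_def ext_contract_def)

lemma ext_E_power:
  fixes u :: "'n::{finite,linorder} set \<Rightarrow> 'a::ab_group_add"
  assumes "u \<in> ext_power r" shows "ext_E i j u \<in> ext_power r"
proof (cases r)
  case 0
  have "ext_contract j u I = 0" for I
    using assms unfolding 0 by (simp add: ext_contract_def ext_power_def)
  then have "ext_contract j u = (\<lambda>I. 0)" by blast
  then show ?thesis unfolding ext_E_def by (simp add: ext_wedge_0 ext_power_def)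
next
  case (Suc r')
  then show ?thesis using assms unfolding ext_E_def
    by (simp add: ext_wedge_power ext_contract_power)
qed

context D_module begin

lemma d_0: "d i 0 = 0" using d_add[of i 0 0] by simp
lemma d_minus: "d i (- p) = - d i p"
  using d_add[of i p "- p"] d_0[of i] by (simp add: eq_neg_iff_add_eq_0 add.commute)
lemma d_sum: "d i (sum h A) = (\<Sum>k\<in>A. d i (h k))"
  by (induction A rule: infinite_finite_induct) (simp_all add: d_0 d_add)
lemma d_sm: "d i (sm f p) = sm f (d i p) + sm (dA i f) p"
  using d_Leibniz[of i f p] by (simp add: algebra_simps)
end

lemma dA_0: "dA i 0 = 0" using dA_add[of i 0 0] by simp
lemma dA_minus: "dA i (- f) = - dA i f"
  using dA_add[of i f "- f"] dA_0[of i] by (simp add: eq_neg_iff_add_eq_0 add.commute)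
lemma dA_diff: "dA i (f - g) = dA i f - dA i g"
  using dA_add[of i f "- g"] by (simp add: dA_minus)
lemma dA_sum: "dA i (sum h A) = (\<Sum>k\<in>A. dA i (h k))"
  by (induction A rule: infinite_finite_induct) (simp_all add: dA_0 dA_add)
lemma dA_cst: "dA i (cst c) = 0"
  by (simp add: cst_def zero_prod_def dA_single)
lemma cst_add: "cst (a + b) = cst a + cst b" by (simp add: cst_def single_add)
lemma cst_mult: "cst (a * b) = cst a * cst b" by (simp add: cst_def mult_single)
lemma cst_1: "cst 1 = 1" by (simp add: cst_def single_one)

lemma T_act_act:
  fixes sm :: "'n::{finite,linorder} An \<Rightarrow> 'p::ab_group_add \<Rightarrow> 'p"
  assumes "D_module sm d"
  shows "T_act sm d \<xi> (T_act sm d \<eta> u) I =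
    (\<Sum>j\<in>UNIV. \<Sum>k\<in>UNIV. sm (\<xi> j * \<eta> k) (d j (d k (u I)))) +
    (\<Sum>j\<in>UNIV. \<Sum>k\<in>UNIV. sm (\<xi> j * dA j (\<eta> k)) (d k (u I))) +
    (\<Sum>j\<in>UNIV. \<Sum>k\<in>UNIV. \<Sum>l\<in>UNIV. sm (\<xi> j * dA j (dA l (\<eta> k))) (ext_E l k u I)) +
    (\<Sum>j\<in>UNIV. \<Sum>k\<in>UNIV. \<Sum>l\<in>UNIV. sm (\<xi> j * dA l (\<eta> k)) (d j (ext_E l k u I))) +
    (\<Sum>j\<in>UNIV. \<Sum>k\<in>UNIV. \<Sum>l\<in>UNIV. sm (\<eta> j * dA l (\<xi> k)) (d j (ext_E l k u I))) +
    (\<Sum>j\<in>UNIV. \<Sum>k\<in>UNIV. \<Sum>i\<in>UNIV. \<Sum>l\<in>UNIV. sm (dA i (\<xi> j) * dA l (\<eta> k)) (ext_E i j (ext_E l k u) I))"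
proof -
  interpret D_module sm d by fact
  have E: "ext_E i j (T_act sm d \<eta> u) I = (\<Sum>k\<in>UNIV. sm (\<eta> k) (d k (ext_E i j u I)) +
     (\<Sum>l\<in>UNIV. sm (dA l (\<eta> k)) (ext_E i j (ext_E l k u) I)))" for i j
  proof -
    have 1: "ext_E i j (\<lambda>J. d k (v J)) I = d k (ext_E i j v I)" for k v
      by (rule ext_wedge_additive(3)) (rule d_add)
    have 2: "ext_E i j (\<lambda>J. sm f (v J)) I = sm f (ext_E i j v I)" for f v
      by (rule ext_wedge_additive(3)) (rule scale_right_distrib)
    show ?thesis unfolding T_act_def ext_E_sum ext_E_add 1 2 ..
  qed
  have D: "(\<Sum>j\<in>UNIV. \<Sum>i\<in>UNIV. \<Sum>k\<in>UNIV. sm (dA i (\<xi> j) * \<eta> k) (d k (ext_E i j u I)))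
     = (\<Sum>j\<in>UNIV. \<Sum>k\<in>UNIV. \<Sum>l\<in>UNIV. sm (\<eta> j * dA l (\<xi> k)) (d j (ext_E l k u I)))"
    (is "?l = _")
  proof -
    have "?l = (\<Sum>j\<in>UNIV. \<Sum>k\<in>UNIV. \<Sum>i\<in>UNIV. sm (dA i (\<xi> j) * \<eta> k) (d k (ext_E i j u I)))"
      by (intro sum.cong refl sum.swap)
    also have "\<dots> = (\<Sum>k\<in>UNIV. \<Sum>j\<in>UNIV. \<Sum>i\<in>UNIV. sm (dA i (\<xi> j) * \<eta> k) (d k (ext_E i j u I)))"
      by (rule sum.swap)
    finally show ?thesis by (simp add: mult.commute)
  qed
  have F: "(\<Sum>j\<in>UNIV. \<Sum>i\<in>UNIV. \<Sum>k\<in>UNIV. \<Sum>l\<in>UNIV. sm (dA i (\<xi> j) * dA l (\<eta> k)) (ext_E i j (ext_E l k u) I))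
    = (\<Sum>j\<in>UNIV. \<Sum>k\<in>UNIV. \<Sum>i\<in>UNIV. \<Sum>l\<in>UNIV. sm (dA i (\<xi> j) * dA l (\<eta> k)) (ext_E i j (ext_E l k u) I))"
    by (intro sum.cong refl sum.swap)
  have "T_act sm d \<xi> (T_act sm d \<eta> u) I = (\<Sum>j\<in>UNIV. sm (\<xi> j) (d j (T_act sm d \<eta> u I)) +
                           (\<Sum>i\<in>UNIV. sm (dA i (\<xi> j)) (ext_E i j (T_act sm d \<eta> u) I)))"
    unfolding T_act_def[of sm d \<xi>] ..
  also have "\<dots> = (\<Sum>j\<in>UNIV. sm (\<xi> j) (d j (T_act sm d \<eta> u I))) +
     (\<Sum>j\<in>UNIV. \<Sum>i\<in>UNIV. \<Sum>k\<in>UNIV. sm (dA i (\<xi> j) * \<eta> k) (d k (ext_E i j u I))) +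
     (\<Sum>j\<in>UNIV. \<Sum>i\<in>UNIV. \<Sum>k\<in>UNIV. \<Sum>l\<in>UNIV. sm (dA i (\<xi> j) * dA l (\<eta> k)) (ext_E i j (ext_E l k u) I))"
    unfolding E by (simp add: sum.distrib scale_right_distrib scale_sum_right)
  also have "(\<Sum>j\<in>UNIV. sm (\<xi> j) (d j (T_act sm d \<eta> u I))) =
    (\<Sum>j\<in>UNIV. \<Sum>k\<in>UNIV. sm (\<xi> j * \<eta> k) (d j (d k (u I)))) +
    (\<Sum>j\<in>UNIV. \<Sum>k\<in>UNIV. sm (\<xi> j * dA j (\<eta> k)) (d k (u I))) +
    (\<Sum>j\<in>UNIV. \<Sum>k\<in>UNIV. \<Sum>l\<in>UNIV. sm (\<xi> j * dA j (dA l (\<eta> k))) (ext_E l k u I)) +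
    (\<Sum>j\<in>UNIV. \<Sum>k\<in>UNIV. \<Sum>l\<in>UNIV. sm (\<xi> j * dA l (\<eta> k)) (d j (ext_E l k u I)))"
    unfolding T_act_def by (simp add: d_sum d_add d_sm sum.distrib scale_right_distrib scale_sum_right algebra_simps)
  finally show ?thesis unfolding D F by (simp add: algebra_simps)
qed

lemma T_act_bracket:
  fixes sm :: "'n::{finite,linorder} An \<Rightarrow> 'p::ab_group_add \<Rightarrow> 'p"
  assumes "D_module sm d"
  shows "T_act sm d (gn_bracket \<xi> \<eta>) u I =
    T_act sm d \<xi> (T_act sm d \<eta> u) I - T_act sm d \<eta> (T_act sm d \<xi> u) I"
proof -
  interpret D_module sm d by fact
  let ?A = "\<lambda>\<xi> \<eta>. (\<Sum>j\<in>UNIV. \<Sum>k\<in>UNIV. sm (\<xi> j * \<eta> k) (d j (d k (u I))))"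
  let ?B = "\<lambda>\<xi> \<eta>. (\<Sum>j\<in>UNIV. \<Sum>k\<in>UNIV. sm (\<xi> j * dA j (\<eta> k)) (d k (u I)))"
  let ?C = "\<lambda>\<xi> \<eta>. (\<Sum>j\<in>UNIV. \<Sum>k\<in>UNIV. \<Sum>l\<in>UNIV. sm (\<xi> j * dA j (dA l (\<eta> k))) (ext_E l k u I))"
  let ?F = "\<lambda>\<xi> \<eta>. (\<Sum>j\<in>UNIV. \<Sum>k\<in>UNIV. \<Sum>i\<in>UNIV. \<Sum>l\<in>UNIV. sm (dA i (\<xi> j) * dA l (\<eta> k)) (ext_E i j (ext_E l k u) I))"
  let ?G = "\<lambda>\<xi> \<eta>. (\<Sum>j\<in>UNIV. \<Sum>k\<in>UNIV. \<Sum>i\<in>UNIV. sm (dA i (\<xi> j) * dA j (\<eta> k)) (ext_E i k u I))"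
  have A: "?A \<xi> \<eta> = ?A \<eta> \<xi>" by (subst sum.swap) (simp add: mult.commute d_commute)
  have F': "?F \<eta> \<xi> = (\<Sum>j\<in>UNIV. \<Sum>k\<in>UNIV. \<Sum>i\<in>UNIV. \<Sum>l\<in>UNIV. sm (dA i (\<xi> j) * dA l (\<eta> k)) (ext_E l k (ext_E i j u) I))"
  proof -
    have "(\<Sum>i\<in>UNIV. \<Sum>l\<in>UNIV. sm (dA i (\<eta> k) * dA l (\<xi> j)) (ext_E i k (ext_E l j u) I)) =
      (\<Sum>i\<in>UNIV. \<Sum>l\<in>UNIV. sm (dA i (\<xi> j) * dA l (\<eta> k)) (ext_E l k (ext_E i j u) I))" for j k
      by (subst sum.swap) (simp only: mult.commute)
    then have "?F \<eta> \<xi> = (\<Sum>k\<in>UNIV. \<Sum>j\<in>UNIV. \<Sum>i\<in>UNIV. \<Sum>l\<in>UNIV. sm (dA i (\<xi> j) * dA l (\<eta> k)) (ext_E l k (ext_E i j u) I))"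
      by (simp only:)
    also have "\<dots> = (\<Sum>j\<in>UNIV. \<Sum>k\<in>UNIV. \<Sum>i\<in>UNIV. \<Sum>l\<in>UNIV. sm (dA i (\<xi> j) * dA l (\<eta> k)) (ext_E l k (ext_E i j u) I))"
      by (rule sum.swap)
    finally show ?thesis .
  qed
  have "?F \<xi> \<eta> - ?F \<eta> \<xi> = (\<Sum>j\<in>UNIV. \<Sum>k\<in>UNIV. \<Sum>i\<in>UNIV. \<Sum>l\<in>UNIV. sm (dA i (\<xi> j) * dA l (\<eta> k))
     ((if j = l then ext_E i k u I else 0) - (if k = i then ext_E l j u I else 0)))"
    unfolding F' by (simp add: scale_right_diff_distrib flip: sum_subtractf ext_E_bracket)
  also have "\<dots> = ?G \<xi> \<eta> - (\<Sum>j\<in>UNIV. \<Sum>k\<in>UNIV. \<Sum>l\<in>UNIV. sm (dA k (\<xi> j) * dA l (\<eta> k)) (ext_E l j u I))"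
  proof -
    have "(\<Sum>i\<in>UNIV. \<Sum>l\<in>UNIV. sm (dA i (\<xi> j) * dA l (\<eta> k)) (if k = i then ext_E l j u I else 0)) =
      (\<Sum>l\<in>UNIV. sm (dA k (\<xi> j) * dA l (\<eta> k)) (ext_E l j u I))" for j k
      by (subst sum.swap) (simp add: if_distrib cong: if_cong)
    moreover have "(\<Sum>l\<in>UNIV. sm (dA i (\<xi> j) * dA l (\<eta> k)) (if j = l then ext_E i k u I else 0)) =
      sm (dA i (\<xi> j) * dA j (\<eta> k)) (ext_E i k u I)" for i j k
      by (simp add: if_distrib cong: if_cong)
    ultimately show ?thesis by (simp only: scale_right_diff_distrib sum_subtractf)
  qed
  also have "(\<Sum>j\<in>UNIV. \<Sum>k\<in>UNIV. \<Sum>l\<in>UNIV. sm (dA k (\<xi> j) * dA l (\<eta> k)) (ext_E l j u I)) = ?G \<eta> \<xi>"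
    by (subst sum.swap) (simp add: mult.commute)
  finally have F: "?F \<xi> \<eta> - ?F \<eta> \<xi> = ?G \<xi> \<eta> - ?G \<eta> \<xi>" .
  have B: "(\<Sum>k\<in>UNIV. sm (gn_derivation \<xi> (\<eta> k)) (d k (u I))) = ?B \<xi> \<eta>" for \<xi> \<eta>
    unfolding gn_derivation_def scale_sum_left by (rule sum.swap)
  have C: "(\<Sum>k\<in>UNIV. \<Sum>i\<in>UNIV. sm (dA i (gn_derivation \<xi> (\<eta> k))) (ext_E i k u I)) = ?C \<xi> \<eta> + ?G \<xi> \<eta>" for \<xi> \<eta>
  proof -
    have s: "(\<Sum>k\<in>UNIV. \<Sum>i\<in>UNIV. \<Sum>j\<in>UNIV. g i j k) = (\<Sum>j\<in>UNIV. \<Sum>k\<in>UNIV. \<Sum>i\<in>UNIV. g i j k)" for g :: "'n \<Rightarrow> 'n \<Rightarrow> 'n \<Rightarrow> 'p"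
    proof -
      have "(\<Sum>k\<in>UNIV. \<Sum>i\<in>UNIV. \<Sum>j\<in>UNIV. g i j k) = (\<Sum>k\<in>UNIV. \<Sum>j\<in>UNIV. \<Sum>i\<in>UNIV. g i j k)"
        by (intro sum.cong refl sum.swap)
      also have "\<dots> = (\<Sum>j\<in>UNIV. \<Sum>k\<in>UNIV. \<Sum>i\<in>UNIV. g i j k)" by (rule sum.swap)
      finally show ?thesis .
    qed
    have "(\<Sum>k\<in>UNIV. \<Sum>i\<in>UNIV. sm (dA i (gn_derivation \<xi> (\<eta> k))) (ext_E i k u I)) =
      (\<Sum>k\<in>UNIV. \<Sum>i\<in>UNIV. \<Sum>j\<in>UNIV. sm (dA i (\<xi> j) * dA j (\<eta> k)) (ext_E i k u I)) +
      (\<Sum>k\<in>UNIV. \<Sum>i\<in>UNIV. \<Sum>j\<in>UNIV. sm (\<xi> j * dA i (dA j (\<eta> k))) (ext_E i k u I))"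
      by (simp only: gn_derivation_def dA_sum dA_mult scale_sum_left scale_left_distrib sum.distrib)
    also have "\<dots> = ?G \<xi> \<eta> +
      (\<Sum>j\<in>UNIV. \<Sum>k\<in>UNIV. \<Sum>i\<in>UNIV. sm (\<xi> j * dA i (dA j (\<eta> k))) (ext_E i k u I))"
      by (intro arg_cong2[where f = plus] s)
    also have "\<dots> = ?G \<xi> \<eta> + ?C \<xi> \<eta>" by (simp only: dA_commute)
    finally show ?thesis by (simp only: add.commute)
  qed
  have "T_act sm d (gn_bracket \<xi> \<eta>) u I = ?B \<xi> \<eta> - ?B \<eta> \<xi> + (?C \<xi> \<eta> + ?G \<xi> \<eta>) - (?C \<eta> \<xi> + ?G \<eta> \<xi>)"
    unfolding T_act_def gn_bracket_def dA_diff
    by (simp add: scale_left_diff_distrib sum_subtractf sum.distrib B C)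
  moreover have "T_act sm d \<xi> (T_act sm d \<eta> u) I - T_act sm d \<eta> (T_act sm d \<xi> u) I
    = (?B \<xi> \<eta> - ?B \<eta> \<xi>) + (?C \<xi> \<eta> - ?C \<eta> \<xi>) + (?F \<xi> \<eta> - ?F \<eta> \<xi>)"
    unfolding T_act_act[OF assms] using A by (simp add: algebra_simps)
  ultimately show ?thesis
    by (simp only: F) (simp add: algebra_simps)
qed

lemma T_rep_gn_module:
  fixes sm :: "'n::{finite,linorder} An \<Rightarrow> 'p::ab_group_add \<Rightarrow> 'p"
  assumes "D_module sm d"
  shows "gn_module (T_rep sm d r)"
proof -
  interpret D_module sm d by fact
  let ?M = "T_rep sm d r"
  have ab: "abelian_group ?M"
  proof (rule abelian_groupI)
    fix u assume "u \<in> carrier ?M"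
    then show "\<exists>v\<in>carrier ?M. v \<oplus>\<^bsub>?M\<^esub> u = \<zero>\<^bsub>?M\<^esub>"
      by (intro bexI[of _ "\<lambda>I. - u I"]) (simp_all add: T_rep_def ext_power_def)
  qed (simp_all add: T_rep_def ext_power_def algebra_simps)
  have mod: "Module.module complex_ring ?M"
  proof (rule moduleI)
    show "cring complex_ring" by (rule cring_from_type_algebra)
    show "abelian_group ?M" by (rule ab)
  qed (simp_all add: T_rep_def ring_of_type_algebra_def ext_power_def cst_add cst_mult cst_1
      scale_left_distrib scale_right_distrib fun_eq_iff)
  interpret M: Module.module complex_ring ?M by (rule mod)
  have E: "ext_E i j u I = 0" if "u \<in> ext_power r" "card I \<noteq> r" for i j I and u :: "'n set \<Rightarrow> 'p"
    using ext_E_power[OF that(1), of i j] that(2) by (simp add: ext_power_def)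
  have closed: "T_act sm d \<xi> u \<in> ext_power r" if "u \<in> ext_power r" for \<xi> u
    using that by (simp add: T_act_def ext_power_def E[OF that] d_0)
  have minus: "\<ominus>\<^bsub>?M\<^esub> u = (\<lambda>I. - u I)" if "u \<in> carrier ?M" for u
    by (rule M.minus_equality) (use that in \<open>simp_all add: T_rep_def ext_power_def\<close>)
  show ?thesis
  proof
    fix u v \<xi> \<eta> c assume u: "u \<in> carrier ?M"
    then have u': "u \<in> ext_power r" by (simp add: T_rep_def)
    show "act ?M \<xi> u \<in> carrier ?M" using closed[OF u'] by (simp add: T_rep_def)
    show "act ?M (\<lambda>j. \<xi> j + \<eta> j) u = act ?M \<xi> u \<oplus>\<^bsub>?M\<^esub> act ?M \<eta> u"
      by (simp add: T_rep_def T_act_def dA_add scale_left_distrib sum.distrib fun_eq_iff add_ac)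
    show "act ?M (\<lambda>j. cst c * \<xi> j) u = c \<odot>\<^bsub>?M\<^esub> act ?M \<xi> u"
      by (simp add: T_rep_def T_act_def dA_mult dA_cst scale_right_distrib scale_sum_right)
    have Es: "ext_E i j (\<lambda>J. sm f (u J)) I = sm f (ext_E i j u I)" for i j f I
      by (rule ext_wedge_additive(3)) (rule scale_right_distrib)
    show "act ?M \<xi> (c \<odot>\<^bsub>?M\<^esub> u) = c \<odot>\<^bsub>?M\<^esub> act ?M \<xi> u"
      by (simp add: T_rep_def T_act_def d_sm dA_cst Es scale_right_distrib scale_sum_right mult.commute)
    show "act ?M (gn_bracket \<xi> \<eta>) u = act ?M \<xi> (act ?M \<eta> u) \<ominus>\<^bsub>?M\<^esub> act ?M \<eta> (act ?M \<xi> u)"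
    proof -
      have "act ?M \<eta> (act ?M \<xi> u) \<in> carrier ?M" using closed u' by (simp add: T_rep_def)
      then show ?thesis unfolding a_minus_def
        by (simp only: minus) (simp add: T_rep_def fun_eq_iff T_act_bracket[OF assms])
    qed
    assume v: "v \<in> carrier ?M"
    show "act ?M \<xi> (u \<oplus>\<^bsub>?M\<^esub> v) = act ?M \<xi> u \<oplus>\<^bsub>?M\<^esub> act ?M \<xi> v"
      by (simp add: T_rep_def T_act_def d_add ext_E_add scale_right_distrib sum.distrib fun_eq_iff add_ac)
  qed
qed

lemma ext_E_tensor:
  fixes sm :: "'n::{finite,linorder} An \<Rightarrow> 'p::ab_group_add \<Rightarrow> 'p"
  assumes "D_module sm d"
  shows "ext_E i j (tensor sm p v) = tensor sm p (ext_E i j v)"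
proof -
  interpret D_module sm d by fact
  show ?thesis unfolding tensor_def
    by (rule ext, rule ext_wedge_additive(3)) (simp add: cst_add scale_left_distrib)
qed

lemma T_act_tensor:
  fixes sm :: "'n::{finite,linorder} An \<Rightarrow> 'p::ab_group_add \<Rightarrow> 'p"
  assumes "D_module sm d"
  shows "T_act sm d (\<lambda>k. if k = j then f else 0) (tensor sm p v) I =
    tensor sm (sm f (d j p)) v I + (\<Sum>i\<in>UNIV. tensor sm (sm (dA i f) p) (ext_E i j v) I)"
proof -
  interpret D_module sm d by fact
  have "T_act sm d (\<lambda>k. if k = j then f else 0) u I = (\<Sum>k\<in>UNIV. if k = j then sm f (d j (u I)) + (\<Sum>i\<in>UNIV. sm (dA i f) (ext_E i j u I)) else 0)" for u
    unfolding T_act_def by (intro sum.cong refl) (simp add: dA_0)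
  then have 1: "T_act sm d (\<lambda>k. if k = j then f else 0) u I = sm f (d j (u I)) + (\<Sum>i\<in>UNIV. sm (dA i f) (ext_E i j u I))" for u
    by simp
  show ?thesis unfolding 1 ext_E_tensor[OF assms]
    by (simp add: tensor_def d_sm dA_cst mult.commute)
qed

lemma T_pi_tensor:
  fixes sm :: "'n::{finite,linorder} An \<Rightarrow> 'p::ab_group_add \<Rightarrow> 'p"
  assumes "D_module sm d"
  shows "T_pi d (tensor sm p v) I = (\<Sum>i\<in>UNIV. tensor sm (d i p) (ext_wedge i v) I)"
proof -
  interpret D_module sm d by fact
  have "ext_wedge i (\<lambda>J. sm (cst (v J)) (d i p)) I = sm (cst (ext_wedge i v I)) (d i p)" for i
    by (rule ext_wedge_additive(1)) (simp add: cst_add scale_left_distrib)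
  then show ?thesis unfolding T_pi_def tensor_def by (simp add: d_sm dA_cst)
qed

lemma tensor_expand:
  fixes sm :: "'n::{finite,linorder} An \<Rightarrow> 'p::ab_group_add \<Rightarrow> 'p"
  assumes "D_module sm d"
  shows "u I = (\<Sum>J\<in>UNIV. tensor sm (u J) (ext_basis J) I)"
proof -
  interpret D_module sm d by fact
  have "cst 0 = (0 :: 'n An)" by (simp add: cst_def)
  then have "(\<Sum>J\<in>UNIV. tensor sm (u J) (ext_basis J) I) = (\<Sum>J\<in>UNIV. if I = J then u J else 0)"
    by (intro sum.cong) (auto simp: tensor_def ext_basis_def cst_1)
  then show ?thesis by simp
qed

end

theory Submission
  imports Defs
begin

text \<open>
  Read \<open>T(P, V(\<delta>\<^sub>r, r)) = P \<otimes> \<Lambda>\<^sup>r\<close> as the space of \<open>P\<close>-valued differential \<open>r\<close>-forms; then \<open>\<pi>\<close> is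
  the de Rham differential.  The decisive fact is that \<open>\<g>\<^sub>n\<close> acts by Lie derivatives: Cartan's
  formula \<open>\<xi> u = \<pi> (\<iota>\<^sub>\<xi> u) + \<iota>\<^sub>\<xi> (\<pi> u)\<close> holds, where \<open>\<iota>\<^sub>\<xi>\<close> is the contraction with \<open>\<xi>\<close>
  (\<open>Cartan_formula\<close>).  Contraction, in contrast to the action, is \<open>A\<^sub>n\<close>-linear in \<open>\<xi>\<close>.

  Simplicity of \<open>L(P, r + 1)\<close> (\<open>simple_L\<close>).  Let \<open>N\<close> be a nonzero submodule and let \<open>K\<close> consist of
  the \<open>r\<close>-forms \<open>u\<close> with \<open>\<pi> (f u) \<in> N\<close> for all \<open>f \<in> A\<^sub>n\<close>.  Then \<open>K\<close> is stable under \<open>A\<^sub>n\<close> and under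
  \<open>\<g>\<^sub>n\<close>.  Let \<open>0 \<noteq> w \<in> N\<close>.  As \<open>w\<close> is in the image of \<open>\<pi>\<close>, \<open>\<pi> w = 0\<close> holds
  and so \<open>\<pi> (\<iota>\<^sub>\<xi> w) = \<xi> w \<in> N\<close> for all \<open>\<xi>\<close>; for the \<open>\<xi> = f d\<^sub>j\<close> this says that \<open>K\<close> contains the
  contractions of \<open>w\<close> with the \<open>d\<^sub>j\<close>.  They are not all zero, since \<open>w\<close> has positive degree, so \<open>K \<noteq> 0\<close>.  But a subspace
  stable under both \<open>A\<^sub>n\<close> and \<open>\<g>\<^sub>n\<close> is stable under each \<open>d\<^sub>j \<otimes> 1\<close> and, since \<open>d\<^sub>i x\<^sub>i = 1\<close>, under each
  matrix unit \<open>1 \<otimes> E\<^sub>i\<^sub>j\<close>.  The diagonal matrix units isolate a single component, the others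
  move it to any position, and simplicity of \<open>P\<close> over \<open>D\<^sub>n\<close> gives \<open>K = P \<otimes> \<Lambda>\<^sup>r\<close>
  (\<open>A_stable_g_submodule\<close>).  Hence \<open>N = L(P, r + 1)\<close>.

  The quotients.  If \<open>\<g>\<^sub>n u \<subseteq> L(P, r)\<close>, then \<open>\<xi> (\<pi> u) = \<pi> (\<xi> u) = 0\<close> for all \<open>\<xi>\<close>, and a form of
  positive degree killed by \<open>\<g>\<^sub>n\<close> is zero, again because the matrix units can be recovered.  So
  the space \<open>L\<close> with the tilde is the kernel of \<open>\<pi>\<close> (\<open>Lt_space_eq\<close>), and the first isomorphism
  theorem identifies the quotient with \<open>L(P, r + 1)\<close>.

  The ends of the complex.  In degree \<open>0\<close> the module is simple exactly when no nonzero element of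
  \<open>P\<close> is killed by all \<open>d\<^sub>i\<close>; such an element \<open>p\<close> makes \<open>f \<mapsto> f p\<close> an isomorphism from the simple
  \<open>D\<^sub>n\<close>-module \<open>A\<^sub>n\<close> onto \<open>P\<close>.  For \<open>P = A\<^sub>n\<close> the kernel of \<open>\<pi>\<close> in degree \<open>0\<close> is the space of constants, so that
  \<open>A\<^sub>n / \<complex>\<close> is \<open>L(A\<^sub>n, 1)\<close>.  In degree \<open>n\<close> the submodule \<open>L(P, n)\<close> is simple and corresponds to
  \<open>\<Sum>\<^sub>i d\<^sub>i P\<close>, and by Cartan's formula \<open>\<g>\<^sub>n\<close> maps every form of top degree into it.
\<close>

section \<open>Homomorphic images of modules over \<open>\<g>\<^sub>n\<close>\<close>

text \<open>
  Besides the first isomorphism theorem, surjective homomorphisms serve to obtain the module axioms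
  of quotients, of \<open>L(P, r)\<close> and of \<open>A\<^sub>n\<close> from those of the modules \<open>T(P, V)\<close>.
\<close>

definition gn_epi :: "('m \<Rightarrow> 'k) \<Rightarrow> ('n::finite, 'm) gn_rep \<Rightarrow> ('n, 'k) gn_rep \<Rightarrow> bool" where
  "gn_epi \<phi> M L \<longleftrightarrow> \<phi> ` carrier M = carrier L \<and> \<phi> \<zero>\<^bsub>M\<^esub> = \<zero>\<^bsub>L\<^esub> \<and>
     (\<forall>u\<in>carrier M. \<forall>v\<in>carrier M. \<phi> (u \<oplus>\<^bsub>M\<^esub> v) = \<phi> u \<oplus>\<^bsub>L\<^esub> \<phi> v) \<and>
     (\<forall>c. \<forall>u\<in>carrier M. \<phi> (c \<odot>\<^bsub>M\<^esub> u) = c \<odot>\<^bsub>L\<^esub> \<phi> u) \<and>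
     (\<forall>\<xi>. \<forall>u\<in>carrier M. \<phi> (act M \<xi> u) = act L \<xi> (\<phi> u))"

lemma carrier_complex_ring [simp]: "c \<in> carrier complex_ring"
  by (simp add: ring_of_type_algebra_def)

lemma gn_submoduleD:
  assumes "gn_module M" and "gn_submodule N M"
  shows "N \<subseteq> carrier M" and "\<zero>\<^bsub>M\<^esub> \<in> N"
    and "u \<in> N \<Longrightarrow> v \<in> N \<Longrightarrow> u \<oplus>\<^bsub>M\<^esub> v \<in> N"
    and "u \<in> N \<Longrightarrow> \<ominus>\<^bsub>M\<^esub> u \<in> N"
    and "u \<in> N \<Longrightarrow> c \<odot>\<^bsub>M\<^esub> u \<in> N"
    and "u \<in> N \<Longrightarrow> act M \<xi> u \<in> N"
    and "abelian_subgroup N M"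
proof -
  interpret gn_module M by fact
  have N: "submodule N complex_ring M" and a: "\<forall>\<xi>. \<forall>u\<in>N. act M \<xi> u \<in> N"
    using assms(2) by (auto simp: gn_submodule_def)
  have g: "subgroup N (add_monoid M)" using N by (rule submodule.axioms(1))
  show ag: "abelian_subgroup N M"
    using additive_subgroupI[OF g] by (rule abelian_subgroupI3) unfold_locales
  interpret abelian_subgroup N M by (rule ag)
  show "N \<subseteq> carrier M" by (rule a_subset)
  show "\<zero>\<^bsub>M\<^esub> \<in> N" by simp
  show "u \<in> N \<Longrightarrow> v \<in> N \<Longrightarrow> u \<oplus>\<^bsub>M\<^esub> v \<in> N" by simp
  show "u \<in> N \<Longrightarrow> \<ominus>\<^bsub>M\<^esub> u \<in> N" by simp
  show "u \<in> N \<Longrightarrow> c \<odot>\<^bsub>M\<^esub> u \<in> N" using submoduleE(4)[OF N] by simp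
  show "u \<in> N \<Longrightarrow> act M \<xi> u \<in> N" using a by blast
qed

lemma gn_submoduleI:
  assumes "gn_module M" and "N \<subseteq> carrier M" and "\<zero>\<^bsub>M\<^esub> \<in> N"
    and "\<And>u v. u \<in> N \<Longrightarrow> v \<in> N \<Longrightarrow> u \<oplus>\<^bsub>M\<^esub> v \<in> N"
    and sm: "\<And>c u. u \<in> N \<Longrightarrow> c \<odot>\<^bsub>M\<^esub> u \<in> N"
    and "\<And>\<xi> u. u \<in> N \<Longrightarrow> act M \<xi> u \<in> N"
  shows "gn_submodule N M"
proof -
  interpret gn_module M by fact
  \<comment> \<open>Closure under negatives follows from closure under scalars.\<close>
  have "\<ominus>\<^bsub>M\<^esub> u = (- 1) \<odot>\<^bsub>M\<^esub> u" if "u \<in> carrier M" for u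
  proof (rule minus_equality[OF _ that])
    have "(- 1) \<odot>\<^bsub>M\<^esub> u \<oplus>\<^bsub>M\<^esub> 1 \<odot>\<^bsub>M\<^esub> u = 0 \<odot>\<^bsub>M\<^esub> u"
      using smult_l_distr[of "- 1" 1 u] that by (simp add: ring_of_type_algebra_def)
    then show "(- 1) \<odot>\<^bsub>M\<^esub> u \<oplus>\<^bsub>M\<^esub> u = \<zero>\<^bsub>M\<^esub>"
      using smult_l_null[of u] smult_one[of u] that by (simp add: ring_of_type_algebra_def)
  qed (use that in simp)
  then show ?thesis unfolding gn_submodule_def
    by (intro conjI submoduleI) (use assms in \<open>auto simp: subset_iff\<close>)
qed

lemma gn_epi_module:
  assumes M: "gn_module M" and e: "gn_epi \<phi> M L"
  shows "gn_module L"
proof -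
  interpret M: gn_module M by fact
  have c: "carrier L = \<phi> ` carrier M" and z: "\<zero>\<^bsub>L\<^esub> = \<phi> \<zero>\<^bsub>M\<^esub>" using e by (auto simp: gn_epi_def)
  have a: "\<phi> u \<oplus>\<^bsub>L\<^esub> \<phi> v = \<phi> (u \<oplus>\<^bsub>M\<^esub> v)" if "u \<in> carrier M" "v \<in> carrier M" for u v
    using e that by (auto simp: gn_epi_def)
  have s: "k \<odot>\<^bsub>L\<^esub> \<phi> u = \<phi> (k \<odot>\<^bsub>M\<^esub> u)" if "u \<in> carrier M" for u k
    using e that by (auto simp: gn_epi_def)
  have x: "act L \<xi> (\<phi> u) = \<phi> (act M \<xi> u)" if "u \<in> carrier M" for u \<xi>
    using e that by (auto simp: gn_epi_def)
  have ab: "abelian_group L"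
  proof (rule abelian_groupI)
    fix U assume "U \<in> carrier L"
    then obtain u where "u \<in> carrier M" "U = \<phi> u" by (auto simp: c)
    then show "\<exists>V\<in>carrier L. V \<oplus>\<^bsub>L\<^esub> U = \<zero>\<^bsub>L\<^esub>"
      by (intro bexI[of _ "\<phi> (\<ominus>\<^bsub>M\<^esub> u)"]) (simp_all add: c a z M.l_neg)
  qed (auto simp: c a z M.a_ac)
  have mod: "Module.module complex_ring L"
    by (rule moduleI[OF M.is_cring ab])
      (auto simp: c a s M.smult_l_distr M.smult_r_distr M.smult_assoc1)
  interpret L: Module.module complex_ring L by (rule mod)
  have m: "\<ominus>\<^bsub>L\<^esub> \<phi> u = \<phi> (\<ominus>\<^bsub>M\<^esub> u)" if "u \<in> carrier M" for u
    by (rule L.minus_equality) (use that in \<open>simp_all add: c a z M.l_neg\<close>)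
  show ?thesis
    by unfold_locales
      (auto simp: c a s x m a_minus_def M.act_closed M.act_add M.act_smult M.add_act M.smult_act
        M.bracket_act)
qed

text \<open>
  The operations of the quotient are defined as unions over all representatives.  Such a union
  is a single coset because the operation is additive and maps \<open>N\<close> into itself.
\<close>

lemma gn_quot_proj:
  assumes M: "gn_module M" and N: "gn_submodule N M"
  shows "gn_epi (a_r_coset M N) M (gn_quot M N)"
    and "u \<in> carrier M \<Longrightarrow> v \<in> carrier M \<Longrightarrow>
      N +>\<^bsub>M\<^esub> u = N +>\<^bsub>M\<^esub> v \<longleftrightarrow> v \<ominus>\<^bsub>M\<^esub> u \<in> N"
proof -
  interpret M: gn_module M by fact
  interpret abelian_subgroup N M by (rule gn_submoduleD(7)[OF M N])
  note D = gn_submoduleD[OF M N]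
  show eq: "N +>\<^bsub>M\<^esub> u = N +>\<^bsub>M\<^esub> v \<longleftrightarrow> v \<ominus>\<^bsub>M\<^esub> u \<in> N"
    if "u \<in> carrier M" "v \<in> carrier M" for u v
  proof -
    have "v \<in> N +>\<^bsub>M\<^esub> u \<longleftrightarrow> v \<ominus>\<^bsub>M\<^esub> u \<in> N"
      using a_rcos_module[OF that] by (simp add: a_minus_def)
    then show ?thesis
      using a_rcos_self[OF that(2)] M.a_repr_independence[OF _ that(1) a_subgroup] by blast
  qed
  have im: "(\<Union>v\<in>N +>\<^bsub>M\<^esub> u. N +>\<^bsub>M\<^esub> h v) = N +>\<^bsub>M\<^esub> h u"
    if u: "u \<in> carrier M" and h: "\<And>v. v \<in> carrier M \<Longrightarrow> h v \<in> carrier M"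
      "\<And>v w. v \<in> carrier M \<Longrightarrow> w \<in> carrier M \<Longrightarrow> h (v \<oplus>\<^bsub>M\<^esub> w) = h v \<oplus>\<^bsub>M\<^esub> h w"
      "\<And>v. v \<in> N \<Longrightarrow> h v \<in> N" for h u
  proof -
    have "N +>\<^bsub>M\<^esub> h v = N +>\<^bsub>M\<^esub> h u" if v: "v \<in> N +>\<^bsub>M\<^esub> u" for v
    proof -
      obtain w where w: "w \<in> N" "v = w \<oplus>\<^bsub>M\<^esub> u" using v by (auto simp: a_r_coset_def')
      then have "w \<in> carrier M" using D(1) by auto
      then have "h v = h w \<oplus>\<^bsub>M\<^esub> h u" using w h u by simp
      then have "h v \<in> N +>\<^bsub>M\<^esub> h u" using h(3)[OF w(1)] by (auto simp: a_r_coset_def')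
      then show ?thesis using M.a_repr_independence[OF _ h(1)[OF u] a_subgroup] by metis
    qed
    then show ?thesis using a_rcos_self[OF u] by blast
  qed
  show "gn_epi (a_r_coset M N) M (gn_quot M N)"
    unfolding gn_epi_def
    by (auto simp: gn_quot_def A_RCOSETS_def' a_rcos_sum D(1) im D M.smult_r_distr
        M.act_add M.act_closed)
qed

lemma gn_module_quot:
  assumes "gn_module M" and "gn_submodule N M"
  shows "gn_module (gn_quot M N)"
  using gn_epi_module gn_quot_proj(1) assms by blast

lemma gn_epi_minus:
  assumes M: "gn_module M" and e: "gn_epi \<phi> M L" and uv: "u \<in> carrier M" "v \<in> carrier M"
  shows "\<phi> (u \<ominus>\<^bsub>M\<^esub> v) = \<phi> u \<ominus>\<^bsub>L\<^esub> \<phi> v"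
proof -
  interpret M: gn_module M by fact
  interpret L: gn_module L by (rule gn_epi_module[OF M e])
  have c: "carrier L = \<phi> ` carrier M" using e by (auto simp: gn_epi_def)
  have "\<ominus>\<^bsub>L\<^esub> \<phi> v = \<phi> (\<ominus>\<^bsub>M\<^esub> v)"
  proof (rule L.minus_equality)
    show "\<phi> (\<ominus>\<^bsub>M\<^esub> v) \<oplus>\<^bsub>L\<^esub> \<phi> v = \<zero>\<^bsub>L\<^esub>"
    proof -
      have "\<phi> (\<ominus>\<^bsub>M\<^esub> v \<oplus>\<^bsub>M\<^esub> v) = \<phi> (\<ominus>\<^bsub>M\<^esub> v) \<oplus>\<^bsub>L\<^esub> \<phi> v"
        using e uv(2) M.M.a_inv_closed[OF uv(2)] unfolding gn_epi_def by blast
      then show ?thesis using e uv(2) by (simp add: M.l_neg gn_epi_def)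
    qed
  qed (use uv c in auto)
  then show ?thesis using e uv by (simp add: a_minus_def gn_epi_def)
qed

lemma gn_epi_kernel:
  assumes M: "gn_module M" and e: "gn_epi \<phi> M L"
  shows "gn_submodule {u\<in>carrier M. \<phi> u = \<zero>\<^bsub>L\<^esub>} M"
proof -
  interpret M: gn_module M by fact
  interpret L: gn_module L by (rule gn_epi_module[OF M e])
  have "act L \<xi> \<zero>\<^bsub>L\<^esub> = \<zero>\<^bsub>L\<^esub>" for \<xi>
    using L.act_smult[of "\<zero>\<^bsub>L\<^esub>" \<xi> 0] L.smult_l_null[of "\<zero>\<^bsub>L\<^esub>"]
      L.smult_l_null[OF L.act_closed[of "\<zero>\<^bsub>L\<^esub>" \<xi>]]
    by (simp add: ring_of_type_algebra_def)
  then show ?thesis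
    by (intro gn_submoduleI[OF M]) (use e in \<open>auto simp: gn_epi_def M.act_closed\<close>)
qed

lemma gn_quot_kernel_isomorphic:
  assumes M: "gn_module M" and e: "gn_epi \<phi> M L"
  shows "gn_isomorphic (gn_quot M {u\<in>carrier M. \<phi> u = \<zero>\<^bsub>L\<^esub>}) L"
proof -
  let ?N = "{u\<in>carrier M. \<phi> u = \<zero>\<^bsub>L\<^esub>}"
  let ?q = "a_r_coset M ?N"
  interpret M: gn_module M by fact
  interpret L: gn_module L by (rule gn_epi_module[OF M e])
  note N = gn_epi_kernel[OF M e]
  note q = gn_quot_proj[OF M N]
  interpret Q: gn_module "gn_quot M ?N" by (rule gn_module_quot[OF M N])
  have c: "carrier (gn_quot M ?N) = ?q ` carrier M" "carrier L = \<phi> ` carrier M"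
    using q(1) e by (auto simp: gn_epi_def)
  have eq: "?q u = ?q v \<longleftrightarrow> \<phi> u = \<phi> v" if "u \<in> carrier M" "v \<in> carrier M" for u v
  proof -
    have "\<phi> v \<ominus>\<^bsub>L\<^esub> \<phi> u = \<zero>\<^bsub>L\<^esub> \<longleftrightarrow> \<phi> u = \<phi> v"
      using that c(2) L.minus_equality L.minus_minus L.r_neg L.a_inv_closed
      by (metis L.minus_eq image_eqI)
    then show ?thesis using q(2)[OF that] that by (simp add: gn_epi_minus[OF M e])
  qed
  define \<psi> where "\<psi> = \<phi> \<circ> inv_into (carrier M) ?q"
  have \<psi>: "\<psi> (?q u) = \<phi> u" if u: "u \<in> carrier M" for u
  proof -
    have "?q u \<in> ?q ` carrier M" using u by (rule imageI)
    then have "?q (inv_into (carrier M) ?q (?q u)) = ?q u" "inv_into (carrier M) ?q (?q u) \<in> carrier M"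
      by (rule f_inv_into_f, rule inv_into_into)
    then have "\<phi> (inv_into (carrier M) ?q (?q u)) = \<phi> u" using eq[OF _ u] by blast
    then show ?thesis by (simp add: \<psi>_def)
  qed
  have "bij_betw \<psi> (carrier (gn_quot M ?N)) (carrier L)"
    unfolding bij_betw_def c by (auto simp: inj_on_def \<psi> eq image_image)
  moreover have "?q u \<oplus>\<^bsub>gn_quot M ?N\<^esub> ?q v = ?q (u \<oplus>\<^bsub>M\<^esub> v)" "k \<odot>\<^bsub>gn_quot M ?N\<^esub> ?q u = ?q (k \<odot>\<^bsub>M\<^esub> u)"
    "act (gn_quot M ?N) \<xi> (?q u) = ?q (act M \<xi> u)"
    if "u \<in> carrier M" "v \<in> carrier M" for u v k \<xi>
    using that q(1) by (auto simp: gn_epi_def)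
  ultimately show ?thesis
    unfolding gn_isomorphic_def
    using Q.gn_module_axioms L.gn_module_axioms e
    by (intro conjI exI[of _ \<psi>]) (auto simp: c \<psi> gn_epi_def M.act_closed)
qed

lemma gn_epi_isomorphic:
  assumes M: "gn_module M" and e: "gn_epi \<phi> M L"
    and k: "{u\<in>carrier M. \<phi> u = \<zero>\<^bsub>L\<^esub>} \<subseteq> {\<zero>\<^bsub>M\<^esub>}"
  shows "gn_isomorphic M L"
proof -
  interpret M: gn_module M by fact
  note L = gn_epi_module[OF M e]
  interpret L: gn_module L by (rule L)
  have c: "\<phi> ` carrier M = carrier L" using e by (simp add: gn_epi_def)
  have "inj_on \<phi> (carrier M)"
  proof (rule inj_onI)
    fix u v assume uv: "u \<in> carrier M" "v \<in> carrier M" "\<phi> u = \<phi> v"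
    have "\<phi> v \<in> carrier L" using c uv by blast
    then have "\<phi> (u \<ominus>\<^bsub>M\<^esub> v) = \<zero>\<^bsub>L\<^esub>"
      using gn_epi_minus[OF M e uv(1,2)] uv(3) by (simp add: L.M.minus_eq L.M.r_neg)
    then have "u \<ominus>\<^bsub>M\<^esub> v = \<zero>\<^bsub>M\<^esub>" using k uv M.M.minus_closed by blast
    then show "u = v"
      using uv by (metis M.minus_eq M.minus_equality M.minus_minus M.M.a_inv_closed)
  qed
  then show ?thesis
    unfolding gn_isomorphic_def using e M L c
    by (intro conjI exI[of _ \<phi>]) (auto simp: gn_epi_def bij_betw_def)
qed

lemma simple_gn_module_isomorphic:
  assumes iso: "gn_isomorphic M L" and L: "simple_gn_module L"
  shows "simple_gn_module M"
proof -
  obtain \<phi> where b: "bij_betw \<phi> (carrier M) (carrier L)"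
    and h: "\<forall>u\<in>carrier M. \<forall>v\<in>carrier M. \<phi> (u \<oplus>\<^bsub>M\<^esub> v) = \<phi> u \<oplus>\<^bsub>L\<^esub> \<phi> v"
      "\<forall>c. \<forall>u\<in>carrier M. \<phi> (c \<odot>\<^bsub>M\<^esub> u) = c \<odot>\<^bsub>L\<^esub> \<phi> u"
      "\<forall>\<xi>. \<forall>u\<in>carrier M. \<phi> (act M \<xi> u) = act L \<xi> (\<phi> u)"
    and M: "gn_module M" and gL: "gn_module L"
    using iso unfolding gn_isomorphic_def by blast
  interpret M: gn_module M by (rule M)
  interpret L: gn_module L by (rule gL)
  have c: "\<phi> ` carrier M = carrier L" and inj: "inj_on \<phi> (carrier M)"
    using b by (auto simp: bij_betw_def)
  have z: "\<phi> \<zero>\<^bsub>M\<^esub> = \<zero>\<^bsub>L\<^esub>"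
  proof -
    have "\<phi> \<zero>\<^bsub>M\<^esub> \<in> carrier L" using c M.zero_closed by blast
    then show ?thesis
      using h(2)[rule_format, of "\<zero>\<^bsub>M\<^esub>" 0] M.smult_l_null[of "\<zero>\<^bsub>M\<^esub>"] L.smult_l_null[of "\<phi> \<zero>\<^bsub>M\<^esub>"]
      by (simp add: ring_of_type_algebra_def)
  qed
  show ?thesis unfolding simple_gn_module_def
  proof (intro conjI allI impI)
    show "carrier M \<noteq> {\<zero>\<^bsub>M\<^esub>}" using L c z by (auto simp: simple_gn_module_def)
    fix N assume N: "gn_submodule N M"
    note D = gn_submoduleD[OF M N]
    have "gn_submodule (\<phi> ` N) L"
    proof (rule gn_submoduleI[OF gL])
      show "\<phi> ` N \<subseteq> carrier L" using c D(1) by blast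
      show "\<zero>\<^bsub>L\<^esub> \<in> \<phi> ` N" using z D(2) by (metis image_eqI)
    qed (use D h in \<open>auto simp: subset_iff simp flip: h\<close>)
    then have "\<phi> ` N = {\<zero>\<^bsub>L\<^esub>} \<or> \<phi> ` N = carrier L" using L by (auto simp: simple_gn_module_def)
    then have "\<phi> ` N = \<phi> ` {\<zero>\<^bsub>M\<^esub>} \<or> \<phi> ` N = \<phi> ` carrier M" using z c by simp
    then show "N = {\<zero>\<^bsub>M\<^esub>} \<or> N = carrier M"
      using inj_on_image_eq_iff[OF inj D(1), of "{\<zero>\<^bsub>M\<^esub>}"]
        inj_on_image_eq_iff[OF inj D(1), of "carrier M"] by simp
  qed (rule M)
qed

lemma trivial_gn_quotI:
  assumes M: "gn_module M" and N: "gn_submodule N M"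
    and a: "\<And>\<xi> u. u \<in> carrier M \<Longrightarrow> act M \<xi> u \<in> N"
  shows "trivial_gn_module (gn_quot M N)"
proof -
  interpret M: gn_module M by (rule M)
  note e = gn_quot_proj(1)[OF M N]
  have "act (gn_quot M N) \<xi> U = \<zero>\<^bsub>gn_quot M N\<^esub>" if U: "U \<in> carrier (gn_quot M N)" for \<xi> U
  proof -
    obtain u where u: "u \<in> carrier M" "U = N +>\<^bsub>M\<^esub> u"
      using U e unfolding gn_epi_def by blast
    have "act (gn_quot M N) \<xi> U = N +>\<^bsub>M\<^esub> act M \<xi> u"
      using e u by (simp add: gn_epi_def)
    also have "\<dots> = N"
      by (rule M.a_coset_join2)
        (use a u M.act_closed N in \<open>auto simp: gn_submodule_def dest: submodule.axioms(1)\<close>)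
    finally show ?thesis by (simp add: gn_quot_def)
  qed
  then show ?thesis unfolding trivial_gn_module_def using gn_module_quot[OF M N] by blast
qed

section \<open>Simplicity of \<open>A\<^sub>n\<close> as a \<open>D\<^sub>n\<close>-module\<close>

abbreviation (input) supp where "supp \<equiv> Poly_Mapping.keys"
abbreviation (input) cf where "cf \<equiv> Poly_Mapping.lookup"

lemma lookup_dA:
  "cf (dA i f) (a, b) = of_int (cf a i) * cf f (a, b)
     + of_nat (cf b i + 1) * cf f (a, b + Poly_Mapping.single i 1)"
  by (simp add: dA_def lookup_add lookup_t_ddt lookup_ddx)

lemma lookup_cst_mult: "cf (cst c * f) k = c * cf f k"
proof (induction f rule: An_induct)
  case (single l e)
  then show ?case by (simp add: cst_def mult_single lookup_single when_def)
qed (simp add: distrib_left lookup_add)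

lemma finite_nat_poly_mapping_le:
  fixes b :: "'n::finite \<Rightarrow>\<^sub>0 nat"
  shows "finite {b'. \<forall>i. cf b' i \<le> cf b i}"
proof (rule finite_imageD)
  show "finite (cf ` {b'. \<forall>i. cf b' i \<le> cf b i})"
  proof (rule finite_subset)
    show "finite (PiE UNIV (\<lambda>i. {..cf b i}))" by (rule finite_PiE) auto
  qed auto
  show "inj_on cf {b'. \<forall>i. cf b' i \<le> cf b i}" by (auto intro: inj_onI poly_mapping_eqI)
qed

text \<open>
  The monomials reached from \<open>f\<close> by lowering exponents of the \<open>x\<^sub>i\<close>.  The operators \<open>d\<^sub>i - c\<close> do not
  enlarge this finite set, which makes its cardinality a measure for descent; the set of
  monomials of \<open>f\<close> itself can grow.
\<close>

definition shadow :: "'n::finite An \<Rightarrow> 'n expo set" where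
  "shadow f = (\<Union>(a, b)\<in>supp f. {a} \<times> {b'. \<forall>i. cf b' i \<le> cf b i})"

lemma finite_shadow: "finite (shadow f)"
  unfolding shadow_def using finite_nat_poly_mapping_le by auto

text \<open>
  If \<open>t^a x^b\<close> with \<open>a\<^sub>i \<noteq> 0\<close> occurs in \<open>f\<close>, then \<open>d\<^sub>i f = 0\<close> forces \<open>t^a x^b x\<^sub>i\<close> to occur as well, and so
  on without end.  With \<open>a = 0\<close>, a monomial \<open>x^b\<close> with \<open>b\<^sub>i > 0\<close> contributes \<open>b\<^sub>i x^b / x\<^sub>i\<close> to \<open>d\<^sub>i f\<close>, which
  nothing else cancels.
\<close>

lemma constant_if_dA_0:
  fixes f :: "'n::finite An"
  assumes "\<And>i. dA i f = 0"
  shows "f = cst (cf f 0)"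
proof (rule poly_mapping_eqI)
  fix k :: "'n expo"
  obtain a b where k: "k = (a, b)" by fastforce
  have eq: "of_int (cf a i) * cf f (a, b) + of_nat (cf b i + 1) * cf f (a, b + Poly_Mapping.single i 1) = 0"
    for a b i using lookup_dA[of i f a b] assms by simp
  have "cf f (a, b) = 0" if a0: "a \<noteq> 0" for a b
  proof (rule ccontr)
    assume nz: "cf f (a, b) \<noteq> 0"
    obtain i where i: "cf a i \<noteq> 0" using a0 by (metis lookup_zero poly_mapping_eqI)
    have "cf f (a, b + Poly_Mapping.single i m) \<noteq> 0" for m
    proof (induction m)
      case 0 show ?case using nz by simp
    next
      case (Suc m)
      have "b + Poly_Mapping.single i m + Poly_Mapping.single i 1 = b + Poly_Mapping.single i (Suc m)"
        by (simp add: add.assoc flip: single_add)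
      then show ?case using eq[of a i "b + Poly_Mapping.single i m"] Suc i by auto
    qed
    then have "(\<lambda>m. (a, b + Poly_Mapping.single i m)) ` UNIV \<subseteq> supp f" by (auto simp: in_keys_iff)
    then have "finite ((\<lambda>m::nat. (a, b + Poly_Mapping.single i m)) ` UNIV)"
      by (rule finite_subset) simp
    moreover have "inj (\<lambda>m::nat. (a, b + Poly_Mapping.single i m))"
      by (rule injI) (metis Pair_inject add_left_imp_eq lookup_single_eq)
    ultimately show False using finite_imageD by blast
  qed
  moreover have "cf f (0, b) = 0" if b0: "b \<noteq> 0" for b
  proof -
    obtain i where i: "cf b i \<noteq> 0" using b0 by (metis lookup_zero poly_mapping_eqI)
    have "(b - Poly_Mapping.single i 1) + Poly_Mapping.single i 1 = b"
      by (rule poly_mapping_eqI) (use i in \<open>auto simp: lookup_add lookup_minus lookup_single when_def\<close>)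
    then show ?thesis using eq[of 0 i "b - Poly_Mapping.single i 1"]
      by (simp del: of_nat_add of_nat_Suc)
  qed
  ultimately show "cf f k = cf (cst (cf f 0)) k"
    unfolding k by (cases "a = 0"; cases "b = 0") (auto simp: cst_def lookup_single when_def zero_prod_def)
qed

text \<open>
  Take a nonzero \<open>f\<close> in the submodule with minimal shadow, and a monomial \<open>t^a x^b\<close> of \<open>f\<close> for which
  \<open>b\<close> has the largest total degree among those with this \<open>a\<close>.  The operator \<open>d\<^sub>i - a\<^sub>i\<close> removes it
  from the shadow, hence kills \<open>f\<close>.  Then \<open>t^(-a) f\<close> is killed by all \<open>d\<^sub>i\<close>, so it is a nonzero
  constant in the submodule.
\<close>

lemma simple_An: "simple_D_module (*) (dA :: 'n::finite \<Rightarrow> 'n An \<Rightarrow> 'n An)"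
  unfolding simple_D_module_def
proof (intro conjI allI impI)
  show D: "D_module (*) (dA :: 'n \<Rightarrow> _)" by (rule D_module_An)
  show "(UNIV :: 'n An set) \<noteq> {0}" by (metis UNIV_I singletonD zero_neq_one)
  fix S assume S: "D_submodule (*) (dA :: 'n \<Rightarrow> 'n An \<Rightarrow> 'n An) S"
  interpret D_module "(*)" "dA :: 'n \<Rightarrow> 'n An \<Rightarrow> 'n An" by (rule D)
  have sub: "subspace S" and dS: "f \<in> S \<Longrightarrow> dA i f \<in> S" for i f
    using S by (auto simp: D_submodule_def)
  show "S = {0} \<or> S = UNIV"
  proof (cases "S \<subseteq> {0}")
    case True then show ?thesis using subspace_0[OF sub] by blast
  next
    case False
    then have "\<exists>f. f \<in> S \<and> f \<noteq> 0" by blast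
    then obtain f where f: "f \<in> S" "f \<noteq> 0"
      and min: "\<And>g. g \<in> S \<Longrightarrow> g \<noteq> 0 \<Longrightarrow> card (shadow f) \<le> card (shadow g)"
      using ex_has_least_nat[of "\<lambda>f. f \<in> S \<and> f \<noteq> 0" _ "\<lambda>f. card (shadow f)"] by blast
    have "supp f \<noteq> {}" using f by simp
    then obtain a b where ab: "(a, b) \<in> supp f"
      and mx: "\<And>b'. (a, b') \<in> supp f \<Longrightarrow> (\<Sum>i\<in>UNIV. cf b' i) \<le> (\<Sum>i\<in>UNIV. cf b i)"
    proof -
      obtain a b0 where 0: "(a, b0) \<in> supp f" using \<open>supp f \<noteq> {}\<close> by fastforce
      define B where "B = {b. (a, b) \<in> supp f}"
      have "B = snd ` (supp f \<inter> {a} \<times> UNIV)" by (force simp: B_def)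
      then have fin: "finite B" by simp
      have "B \<noteq> {}" using 0 by (auto simp: B_def)
      with fin obtain b where b: "b \<in> B" "(\<Sum>i\<in>UNIV. cf b i) = (MAX b\<in>B. \<Sum>i\<in>UNIV. cf b i)"
        by (metis (no_types, lifting) obtains_MAX)
      have "(\<Sum>i\<in>UNIV. cf b' i) \<le> (\<Sum>i\<in>UNIV. cf b i)" if "b' \<in> B" for b'
        unfolding b(2) using that fin by (intro Max_ge) auto
      with b(1) show ?thesis using that[of a b] by (auto simp: B_def)
    qed
    have top: "cf f (a, b') = 0" if le: "\<forall>i. cf b i \<le> cf b' i" and ne: "b' \<noteq> b" for b'
    proof (rule ccontr)
      assume "cf f (a, b') \<noteq> 0"
      then have "(\<Sum>i\<in>UNIV. cf b' i) \<le> (\<Sum>i\<in>UNIV. cf b i)" using mx[of b'] by (simp add: in_keys_iff)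
      moreover obtain i where "cf b' i \<noteq> cf b i" using ne by (metis poly_mapping_eqI)
      then have "cf b i < cf b' i" using le by (metis le_neq_implies_less)
      then have "(\<Sum>i\<in>UNIV. cf b i) < (\<Sum>i\<in>UNIV. cf b' i)"
        using le by (intro sum_strict_mono_ex1) auto
      ultimately show False by simp
    qed
    \<comment> \<open>\<open>g\<close> lies in \<open>S\<close> and its shadow is smaller, since it lacks \<open>(a, b)\<close>.\<close>
    have eig: "dA i f = cst (of_int (cf a i)) * f" for i
    proof -
      define g where "g = dA i f - cst (of_int (cf a i)) * f"
      have g: "g \<in> S" unfolding g_def by (intro subspace_diff sub dS subspace_scale f)
      have lg: "cf g (a', b') = (of_int (cf a' i) - of_int (cf a i)) * cf f (a', b')
          + of_nat (cf b' i + 1) * cf f (a', b' + Poly_Mapping.single i 1)" for a' b'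
        by (simp add: g_def lookup_minus lookup_dA lookup_cst_mult left_diff_distrib)
      have "shadow g \<subseteq> shadow f"
      proof
        fix k assume "k \<in> shadow g"
        then obtain a' b' c where k: "k = (a', c)" "cf g (a', b') \<noteq> 0" "\<forall>j. cf c j \<le> cf b' j"
          by (auto simp: shadow_def in_keys_iff)
        then have "cf f (a', b') \<noteq> 0 \<or> cf f (a', b' + Poly_Mapping.single i 1) \<noteq> 0"
          using lg[of a' b'] by auto
        moreover have "\<forall>j. cf c j \<le> cf (b' + Poly_Mapping.single i 1) j"
          using k(3) by (auto simp: lookup_add intro: le_trans trans_le_add1)
        ultimately show "k \<in> shadow f" using k by (auto simp: shadow_def in_keys_iff)
      qed
      moreover have "(a, b) \<in> shadow f" using ab by (auto simp: shadow_def)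
      moreover have "(a, b) \<notin> shadow g"
      proof
        assume "(a, b) \<in> shadow g"
        then obtain b' where b': "cf g (a, b') \<noteq> 0" "\<forall>j. cf b j \<le> cf b' j"
          by (auto simp: shadow_def in_keys_iff)
        have "cf f (a, b' + Poly_Mapping.single i 1) = 0"
        proof (rule top)
          show "\<forall>j. cf b j \<le> cf (b' + Poly_Mapping.single i 1) j"
            using b'(2) by (auto simp: lookup_add intro: le_trans trans_le_add1)
          have "cf b i < cf (b' + Poly_Mapping.single i 1) i"
            using b'(2) by (simp add: lookup_add le_imp_less_Suc)
          then show "b' + Poly_Mapping.single i 1 \<noteq> b" by auto
        qed
        then show False using b'(1) lg[of a b'] by simp
      qed
      ultimately have "card (shadow g) < card (shadow f)"
        using psubset_card_mono[OF finite_shadow] by blast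
      then have "g = 0" using min[OF g] by fastforce
      then show ?thesis by (simp add: g_def)
    qed
    define h where "h = Poly_Mapping.single (- a, 0) 1 * f"
    have inv: "Poly_Mapping.single (a, 0) 1 * h = f"
      by (simp add: h_def mult_single single_one flip: mult.assoc zero_prod_def)
    have hS: "h \<in> S" unfolding h_def by (intro subspace_scale sub f)
    have "dA i h = 0" for i
    proof -
      have "dA i (Poly_Mapping.single (- a, 0) 1) = - cst (of_int (cf a i)) * Poly_Mapping.single (- a, 0) 1"
        by (simp add: dA_single cst_def mult_single single_uminus del: single_of_int)
      moreover have "- c * s * f + s * (c * f) = 0" for c s :: "'n An"
        by (simp only: mult.left_commute[of s] mult.assoc left_minus flip: minus_mult_left)
      ultimately show ?thesis by (simp only: h_def dA_mult eig)
    qed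
    then have c: "h = cst (cf h 0)" by (rule constant_if_dA_0)
    have "h \<noteq> 0" using inv f by auto
    then have "cf h 0 \<noteq> 0" using c by (auto simp: cst_def)
    then have "g = (g * cst (1 / cf h 0)) * cst (cf h 0)" for g
      by (simp add: mult.assoc cst_1 flip: cst_mult)
    then have "g \<in> S" for g using subspace_scale[OF sub hS] c by metis
    then show ?thesis by blast
  qed
qed

section \<open>Differential forms with values in a \<open>D\<^sub>n\<close>-module\<close>

locale D_forms = D_module sm d
  for sm :: "'n::{finite,linorder} An \<Rightarrow> 'p::ab_group_add \<Rightarrow> 'p" and d
begin

text \<open>The contraction \<open>\<iota>\<^sub>\<xi>\<close> of forms with the vector field \<open>\<xi>\<close>.\<close>

definition iota :: "'n gn \<Rightarrow> ('n set \<Rightarrow> 'p) \<Rightarrow> 'n set \<Rightarrow> 'p" where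
  "iota \<xi> u = (\<lambda>I. \<Sum>j\<in>UNIV. sm (\<xi> j) (ext_contract j u I))"

definition form_mult :: "'n An \<Rightarrow> ('n set \<Rightarrow> 'p) \<Rightarrow> 'n set \<Rightarrow> 'p" where
  "form_mult f u = (\<lambda>I. sm f (u I))"

definition form_add :: "('n set \<Rightarrow> 'p) \<Rightarrow> ('n set \<Rightarrow> 'p) \<Rightarrow> 'n set \<Rightarrow> 'p" (infixl "\<boxplus>" 65) where
  "u \<boxplus> v = (\<lambda>I. u I + v I)"

lemma form_add_0 [simp]: "u \<boxplus> (\<lambda>I. 0) = u" "(\<lambda>I. 0) \<boxplus> u = u"
  by (simp_all add: form_add_def)

lemma ext_d: "ext_wedge i (\<lambda>J. d k (u J)) I = d k (ext_wedge i u I)"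
  "ext_contract i (\<lambda>J. d k (u J)) I = d k (ext_contract i u I)"
  by (rule ext_wedge_additive, rule d_add)+

lemma ext_sm: "ext_wedge i (\<lambda>J. sm f (u J)) I = sm f (ext_wedge i u I)"
  "ext_contract i (\<lambda>J. sm f (u J)) I = sm f (ext_contract i u I)"
  "ext_E i j (\<lambda>J. sm f (u J)) I = sm f (ext_E i j u I)"
  by (rule ext_wedge_additive, rule scale_right_distrib)+

lemma T_pi_eq: "T_pi d u I = (\<Sum>i\<in>UNIV. d i (ext_wedge i u I))"
  by (simp add: T_pi_def ext_d)

lemma ext_wedge_sum: "ext_wedge i (\<lambda>J. \<Sum>k\<in>A. u k J) I = (\<Sum>k\<in>A. ext_wedge i (u k) I)"
  by (induction A rule: infinite_finite_induct) (simp_all add: ext_wedge_0 ext_wedge_add)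

lemma ext_contract_sum: "ext_contract i (\<lambda>J. \<Sum>k\<in>A. u k J) I = (\<Sum>k\<in>A. ext_contract i (u k) I)"
  by (induction A rule: infinite_finite_induct) (simp_all add: ext_contract_0 ext_contract_add)

lemma T_pi_add: "T_pi d (u \<boxplus> v) = T_pi d u \<boxplus> T_pi d v"
  by (simp add: T_pi_eq form_add_def ext_wedge_add d_add sum.distrib fun_eq_iff)

lemma T_pi_cst: "T_pi d (form_mult (cst c) u) = form_mult (cst c) (T_pi d u)"
  by (simp add: T_pi_eq form_mult_def ext_sm d_sm dA_cst scale_sum_right fun_eq_iff)

lemma T_pi_0: "T_pi d (\<lambda>I. 0) = (\<lambda>I. 0)"
  by (simp add: T_pi_eq ext_wedge_0 d_0 fun_eq_iff)

lemma T_pi_power: "u \<in> ext_power r \<Longrightarrow> T_pi d u \<in> ext_power (Suc r)"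
  using ext_wedge_power[of u r] by (simp add: T_pi_eq ext_power_def d_0)

lemma iota_power: "u \<in> ext_power (Suc r) \<Longrightarrow> iota \<xi> u \<in> ext_power r"
  using ext_contract_power[of u r] by (simp add: iota_def ext_power_def)

text \<open>
  The action on \<open>T(P, V(\<delta>\<^sub>r, r))\<close> is the Lie derivative.  Moving \<open>d\<^sub>i\<close> past the coefficients of \<open>\<xi>\<close> in
  \<open>\<pi> (\<iota>\<^sub>\<xi> u)\<close> produces the terms with \<open>E\<^sub>i\<^sub>j\<close>; the remaining mixed terms cancel against those of
  \<open>\<iota>\<^sub>\<xi> (\<pi> u)\<close> by the relation between wedging and contracting.
\<close>

lemma Cartan_formula: "T_act sm d \<xi> u = T_pi d (iota \<xi> u) \<boxplus> iota \<xi> (T_pi d u)"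
proof
  fix I
  have "T_pi d (iota \<xi> u) I = (\<Sum>i\<in>UNIV. \<Sum>j\<in>UNIV.
      sm (\<xi> j) (d i (ext_E i j u I)) + sm (dA i (\<xi> j)) (ext_E i j u I))"
    unfolding T_pi_eq iota_def ext_wedge_sum ext_sm by (simp add: d_sum d_sm ext_E_def)
  also have "\<dots> = (\<Sum>j\<in>UNIV. \<Sum>i\<in>UNIV.
      sm (\<xi> j) (d i (ext_E i j u I)) + sm (dA i (\<xi> j)) (ext_E i j u I))"
    by (rule sum.swap)
  finally have 1: "T_pi d (iota \<xi> u) I = (\<Sum>j\<in>UNIV. \<Sum>i\<in>UNIV.
      sm (\<xi> j) (d i (ext_E i j u I)) + sm (dA i (\<xi> j)) (ext_E i j u I))" .
  have c: "ext_contract j (ext_wedge i u) I = (if i = j then u I else 0) - ext_E i j u I" for i j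
    using ext_contract_wedge[of j i u I] by (simp add: ext_E_def eq_diff_eq)
  have m: "d i (a - b) = d i a - d i b" for i a b
    using d_add[of i a "- b"] by (simp add: d_minus)
  have "ext_contract j (T_pi d u) I = (\<Sum>i\<in>UNIV. d i (ext_contract j (ext_wedge i u) I))" for j
  proof -
    have "T_pi d u = (\<lambda>J. \<Sum>i\<in>UNIV. d i (ext_wedge i u J))" by (rule ext) (rule T_pi_eq)
    then show ?thesis by (simp add: ext_contract_sum ext_d)
  qed
  also have "(\<Sum>i\<in>UNIV. d i (ext_contract j (ext_wedge i u) I)) =
      d j (u I) - (\<Sum>i\<in>UNIV. d i (ext_E i j u I))" for j
  proof -
    have "(\<Sum>i\<in>UNIV. d i (ext_contract j (ext_wedge i u) I)) =
      (\<Sum>i\<in>UNIV. (if i = j then d j (u I) else 0) - d i (ext_E i j u I))"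
      by (intro sum.cong refl) (simp add: c m d_0)
    then show ?thesis by (simp add: sum_subtractf)
  qed
  finally have 2: "iota \<xi> (T_pi d u) I =
      (\<Sum>j\<in>UNIV. sm (\<xi> j) (d j (u I)) - (\<Sum>i\<in>UNIV. sm (\<xi> j) (d i (ext_E i j u I))))"
    by (simp add: iota_def scale_right_diff_distrib scale_sum_right)
  show "T_act sm d \<xi> u I = (T_pi d (iota \<xi> u) \<boxplus> iota \<xi> (T_pi d u)) I"
    unfolding form_add_def 1 2 T_act_def by (simp add: sum.distrib sum_subtractf)
qed

lemma double_eq_0: "p + p = 0 \<Longrightarrow> p = (0::'p)"
proof -
  assume p: "p + p = 0"
  have "p = sm (cst (1/2) * cst (1 + 1)) p" by (simp add: cst_1 flip: cst_mult)
  also have "\<dots> = sm (cst (1/2)) (p + p)"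
    by (simp only: cst_add cst_1 scale_left_distrib scale_one flip: scale_scale)
  finally show "p = 0" using p by simp
qed

text \<open>The \<open>d\<^sub>i\<close> commute and the \<open>e\<^sub>i\<close> anticommute, so exchanging the summation indices changes the sign.\<close>

lemma T_pi_T_pi: "T_pi d (T_pi d u) = (\<lambda>I. 0)"
proof
  fix I
  have e: "T_pi d (T_pi d u) I = (\<Sum>i\<in>UNIV. \<Sum>j\<in>UNIV. d i (d j (ext_wedge i (ext_wedge j u) I)))"
  proof -
    have "T_pi d u = (\<lambda>J. \<Sum>i\<in>UNIV. d i (ext_wedge i u J))" by (rule ext) (rule T_pi_eq)
    then show ?thesis by (simp add: T_pi_eq ext_wedge_sum ext_d d_sum)
  qed
  have "T_pi d (T_pi d u) I = (\<Sum>i\<in>UNIV. \<Sum>j\<in>UNIV. - d j (d i (ext_wedge j (ext_wedge i u) I)))"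
    unfolding e by (subst ext_wedge_wedge) (simp add: d_minus d_commute)
  also have "\<dots> = - T_pi d (T_pi d u) I"
    unfolding e by (subst sum.swap) (simp add: sum_negf)
  finally have "T_pi d (T_pi d u) I + T_pi d (T_pi d u) I = 0"
    by (simp add: eq_neg_iff_add_eq_0)
  then show "T_pi d (T_pi d u) I = 0" by (rule double_eq_0)
qed

lemma iota_0: "iota \<xi> (\<lambda>I. 0) = (\<lambda>I. 0)"
  by (simp add: iota_def ext_contract_0 fun_eq_iff)

lemma T_act_T_pi: "T_act sm d \<xi> (T_pi d u) = T_pi d (iota \<xi> (T_pi d u))"
  by (simp add: Cartan_formula T_pi_T_pi iota_0 form_add_def)

lemma T_pi_T_act: "T_pi d (T_act sm d \<xi> u) = T_act sm d \<xi> (T_pi d u)"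
  unfolding T_act_T_pi by (simp add: Cartan_formula T_pi_add T_pi_T_pi)

lemma T_act_power:
  assumes "u \<in> ext_power r" shows "T_act sm d \<xi> u \<in> ext_power r"
  using ext_E_power[OF assms] assms by (simp add: T_act_def ext_power_def d_0)

abbreviation (input) coord :: "'n \<Rightarrow> 'n An \<Rightarrow> 'n gn" where
  "coord j f \<equiv> (\<lambda>k. if k = j then f else 0)"

definition xvar :: "'n \<Rightarrow> 'n An" where
  "xvar i = Poly_Mapping.single (0, Poly_Mapping.single i 1) 1"

lemma dA_xvar: "dA i (xvar j) = (if i = j then 1 else 0)"
  by (simp add: xvar_def dA_single lookup_single when_def single_one flip: zero_prod_def)

lemma dA_1: "dA i 1 = 0"
  using dA_cst[of i 1] by (simp add: cst_1)

lemma T_act_coord: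
  "T_act sm d (coord j f) u I = sm f (d j (u I)) + (\<Sum>i\<in>UNIV. sm (dA i f) (ext_E i j u I))"
proof -
  have "T_act sm d (coord j f) u I = (\<Sum>k\<in>UNIV. if k = j
      then sm f (d j (u I)) + (\<Sum>i\<in>UNIV. sm (dA i f) (ext_E i j u I)) else 0)"
    unfolding T_act_def by (intro sum.cong refl) (simp add: dA_0)
  then show ?thesis by simp
qed

lemma T_act_coord_1: "T_act sm d (coord j 1) u = (\<lambda>I. d j (u I))"
  by (rule ext) (simp add: T_act_coord dA_1)

lemma T_act_coord_xvar:
  "T_act sm d (coord j (xvar i)) u = form_mult (xvar i) (\<lambda>I. d j (u I)) \<boxplus> ext_E i j u"
proof
  fix I
  have "(\<Sum>k\<in>UNIV. sm (dA k (xvar i)) (ext_E k j u I)) = (\<Sum>k\<in>UNIV. if k = i then ext_E k j u I else 0)"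
    by (intro sum.cong refl) (simp add: dA_xvar)
  then show "T_act sm d (coord j (xvar i)) u I = (form_mult (xvar i) (\<lambda>I. d j (u I)) \<boxplus> ext_E i j u) I"
    by (simp add: T_act_coord form_add_def form_mult_def)
qed

lemma ext_E_diag:
  fixes u :: "'n set \<Rightarrow> 'p"
  shows "ext_E i i u I = (if i \<in> I then u I else 0)"
proof (cases "i \<in> I")
  case True
  then have "insert i (I - {i}) = I" by blast
  then show ?thesis using True
    by (simp add: ext_E_def ext_wedge_def ext_contract_def ext_sign_remove del: insert_Diff_single)
qed (simp add: ext_E_def ext_wedge_def)

text \<open>
  An element killed by \<open>d\<^sub>i\<close> and by \<open>x\<^sub>i d\<^sub>i\<close> is killed by \<open>E\<^sub>i\<^sub>i\<close>, which is the projection to the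
  components whose index contains \<open>i\<close>.  In positive degree every index contains some \<open>i\<close>.
\<close>

lemma T_act_invariants:
  assumes u: "u \<in> ext_power (Suc r)" and inv: "\<And>\<xi>. T_act sm d \<xi> u = (\<lambda>I. 0)"
  shows "u = (\<lambda>I. 0)"
proof
  fix I
  have "(\<lambda>I. d j (u I)) = (\<lambda>I. 0)" for j using inv[of "coord j 1"] by (simp only: T_act_coord_1)
  then have "ext_E i i u = (\<lambda>I. 0)" for i
    using inv[of "coord i (xvar i)"] by (simp add: T_act_coord_xvar form_mult_def form_add_def)
  then have "i \<in> I \<Longrightarrow> u I = 0" for i using ext_E_diag[of i u I] by simp
  moreover have "I = {} \<Longrightarrow> u I = 0" using u by (simp add: ext_power_def)
  ultimately show "u I = 0" by blast
qed

text \<open>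
  For \<open>\<pi> u = 0\<close>, Cartan's formula gives \<open>\<xi> u = \<pi> (\<iota>\<^sub>\<xi> u)\<close>.  Conversely, if \<open>\<xi> u\<close> is always a boundary,
  then \<open>\<pi> u\<close> is an invariant of positive degree.
\<close>

lemma Lt_space_eq: "Lt_space sm d r = {u \<in> ext_power r. T_pi d u = (\<lambda>I. 0)}"
proof (intro equalityI subsetI)
  fix u assume "u \<in> {u \<in> ext_power r. T_pi d u = (\<lambda>I. 0)}"
  then have u: "u \<in> ext_power r" and k: "T_pi d u = (\<lambda>I. 0)" by auto
  have "T_act sm d \<xi> u \<in> L_space d r" for \<xi>
  proof -
    have e: "T_act sm d \<xi> u = T_pi d (iota \<xi> u)"
      by (simp add: Cartan_formula k iota_0 form_add_def)
    show ?thesis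
    proof (cases r)
      case 0
      have "ext_contract j u I = 0" for j I
        using u 0 by (simp add: ext_contract_def ext_power_def)
      then have "iota \<xi> u = (\<lambda>I. 0)" by (simp add: iota_def fun_eq_iff)
      then show ?thesis by (simp add: e 0 T_pi_0 L_space_def)
    next
      case (Suc s)
      then show ?thesis unfolding e L_space_def using iota_power[of u s] u by auto
    qed
  qed
  then show "u \<in> Lt_space sm d r" using u by (simp add: Lt_space_def)
next
  fix u assume "u \<in> Lt_space sm d r"
  then have u: "u \<in> ext_power r" and L: "\<And>\<xi>. T_act sm d \<xi> u \<in> L_space d r"
    by (auto simp: Lt_space_def)
  have "T_pi d v = (\<lambda>I. 0)" if "v \<in> L_space d r" for v
    using that by (auto simp: L_space_def T_pi_0 T_pi_T_pi split: if_splits)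
  then have "T_act sm d \<xi> (T_pi d u) = (\<lambda>I. 0)" for \<xi>
    using L by (simp flip: T_pi_T_act)
  then have "T_pi d u = (\<lambda>I. 0)" by (rule T_act_invariants[OF T_pi_power[OF u]])
  then show "u \<in> {u \<in> ext_power r. T_pi d u = (\<lambda>I. 0)}" using u by blast
qed

lemma T_act_mult:
  "T_act sm d \<xi> (form_mult f u) = form_mult f (T_act sm d \<xi> u) \<boxplus> form_mult (gn_derivation \<xi> f) u"
  by (simp add: fun_eq_iff form_add_def form_mult_def T_act_def ext_sm d_sm gn_derivation_def
      scale_sum_left scale_sum_right scale_right_distrib sum.distrib algebra_simps)

text \<open>The form \<open>p \<otimes> e\<^sub>I\<close>.\<close>

definition single_form :: "'n set \<Rightarrow> 'p \<Rightarrow> 'n set \<Rightarrow> 'p" where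
  "single_form I p = (\<lambda>J. if J = I then p else 0)"

text \<open>The sign is given as a scalar with square \<open>1\<close>, so that multiplying by it once more removes it.\<close>

lemma ext_E_single_form:
  assumes "j \<in> I" "i \<notin> I"
  shows "\<exists>c. \<forall>p. ext_E i j (single_form I p) = form_mult (cst c) (single_form (insert i (I - {j})) p)
     \<and> c * c = 1"
proof -
  let ?K = "insert i (I - {j})"
  have K: "J = ?K" if "i \<in> J" "j \<notin> J - {i}" "insert j (J - {i}) = I" for J
    using that assms by blast
  have K': "insert j (?K - {i}) = I" "i \<noteq> j" using assms by auto
  have mm: "cst (-1) = (-1 :: 'n An)" by (simp add: cst_def single_uminus single_one)
  let ?c = "ext_sign i ?K (ext_sign j (?K - {i}) 1) :: complex"
  have "ext_E i j (single_form I p) J = form_mult (cst ?c) (single_form ?K p) J" for p J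
  proof (cases "J = ?K")
    case True
    show ?thesis unfolding True using K' assms
      by (simp add: ext_E_def ext_wedge_def ext_contract_def single_form_def form_mult_def ext_sign_def
          cst_1 mm)
  next
    case False
    then show ?thesis using K[of J] assms
      by (auto simp: ext_E_def ext_wedge_def ext_contract_def single_form_def form_mult_def)
  qed
  moreover have "?c * ?c = 1" by (simp add: ext_sign_def)
  ultimately show ?thesis by (intro exI[of _ ?c]) (simp add: fun_eq_iff)
qed

text \<open>
  Stability under \<open>A\<^sub>n\<close> in addition to \<open>\<g>\<^sub>n\<close> separates the two factors of the tensor product: the
  subspace becomes stable under \<open>D\<^sub>n \<otimes> 1\<close> and under \<open>1 \<otimes> E\<^sub>i\<^sub>j\<close>.  As the matrix units act irreducibly on the
  exterior power, with one-dimensional weight spaces, only \<open>0\<close> and everything remain.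
\<close>

lemma A_stable_g_submodule:
  assumes P: "simple_D_module sm d" and K: "K \<subseteq> ext_power r" and z: "(\<lambda>I. 0) \<in> K"
    and add: "\<And>u v. u \<in> K \<Longrightarrow> v \<in> K \<Longrightarrow> u \<boxplus> v \<in> K"
    and form_mult: "\<And>f u. u \<in> K \<Longrightarrow> form_mult f u \<in> K"
    and act: "\<And>\<xi> u. u \<in> K \<Longrightarrow> T_act sm d \<xi> u \<in> K"
    and nz: "K \<noteq> {\<lambda>I. 0}"
  shows "K = ext_power r"
proof -
  have d: "(\<lambda>I. d j (u I)) \<in> K" if "u \<in> K" for j u
    using act[OF that, of "coord j 1"] by (simp only: T_act_coord_1)
  have E: "ext_E i j u \<in> K" if "u \<in> K" for i j u
  proof -
    have e: "ext_E i j u = T_act sm d (coord j (xvar i)) u \<boxplus>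
        form_mult (- 1) (form_mult (xvar i) (\<lambda>I. d j (u I)))"
      by (simp add: fun_eq_iff T_act_coord_xvar form_add_def form_mult_def)
    show ?thesis unfolding e using that by (intro add form_mult act d)
  qed
  have UN: "{p. single_form I p \<in> K} = UNIV" if "single_form I p \<in> K" "p \<noteq> 0" for I p
  proof -
    have 0: "single_form I 0 = (\<lambda>I. 0)"
      and a: "single_form I (p + q) = single_form I p \<boxplus> single_form I q"
      and m: "single_form I (sm f p) = form_mult f (single_form I p)"
      and dd: "single_form I (d j p) = (\<lambda>J. d j (single_form I p J))" for p q f j
      by (auto simp: single_form_def form_add_def form_mult_def fun_eq_iff d_0)
    have "D_submodule sm d {p. single_form I p \<in> K}"
      unfolding D_submodule_def subspace_def by (auto simp: 0 a m dd z intro: add form_mult d)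
    then have "{p. single_form I p \<in> K} = {0} \<or> {p. single_form I p \<in> K} = UNIV"
      using P by (auto simp: simple_D_module_def)
    then show ?thesis using that by blast
  qed
  obtain u where u: "u \<in> K" "u \<noteq> (\<lambda>I. 0)" using nz z by blast
  then obtain I where I: "u I \<noteq> 0" by blast
  have up: "u \<in> ext_power r" using u K by blast
  have cI: "card I = r" using I up by (auto simp: ext_power_def)
  \<comment> \<open>Applying \<open>E\<^sub>i\<^sub>i\<close> for all \<open>i \<in> I\<close> leaves only the component at \<open>I\<close>.\<close>
  have "(\<lambda>J. if F \<subseteq> J then u J else 0) \<in> K" for F
  proof (induction F rule: finite_induct[OF finite])
    case 1 show ?case using u by simp
  next
    case (2 i F)
    have "(\<lambda>J. if insert i F \<subseteq> J then u J else 0) = ext_E i i (\<lambda>J. if F \<subseteq> J then u J else 0)"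
      by (auto simp: ext_E_diag fun_eq_iff)
    then show ?case using E[OF 2(3)] by simp
  qed
  moreover have "(\<lambda>J. if I \<subseteq> J then u J else 0) = single_form I (u I)"
  proof
    fix J
    have "J = I" if "I \<subseteq> J" "u J \<noteq> 0"
    proof -
      have "card J = r" using that(2) up by (auto simp: ext_power_def)
      then show ?thesis using card_subset_eq[OF finite that(1)] cI by simp
    qed
    then show "(if I \<subseteq> J then u J else 0) = single_form I (u I) J"
      by (auto simp: single_form_def)
  qed
  ultimately have "single_form I (u I) \<in> K" by metis
  then have UI: "{p. single_form I p \<in> K} = UNIV" using UN I by blast
  \<comment> \<open>Any index \<open>J\<close> of the same size is reached from \<open>I\<close> by exchanging elements one at a time.\<close>
  have all: "{p. single_form J p \<in> K} = UNIV" if "card J = r" for J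
    using that
  proof (induction "card (I - J)" arbitrary: J rule: less_induct)
    case less
    show ?case
    proof (cases "J = I")
      case False
      have "card (I - J) = card (J - I)"
        using less.prems cI by (simp add: card_Diff_subset_Int Int_commute)
      moreover have "I - J \<noteq> {} \<or> J - I \<noteq> {}" using False by blast
      ultimately obtain i j where i: "i \<in> I" "i \<notin> J" and j: "j \<in> J" "j \<notin> I"
        by (metis DiffE card_eq_0_iff ex_in_conv finite)
      let ?J = "insert i (J - {j})"
      have cJ: "card ?J = r" using i j less.prems by (simp add: card.insert_remove card_Diff_singleton)
         (metis card_gt_0_iff Suc_pred empty_iff finite)
      have "I - ?J \<subset> I - J" using i j by blast
      then have "{p. single_form ?J p \<in> K} = UNIV"
        using less.hyps[OF psubset_card_mono cJ] by simp
      moreover have "insert j (?J - {i}) = J" "i \<in> ?J" "j \<notin> ?J" using i j by auto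
      ultimately obtain c where c: "\<And>p. ext_E j i (single_form ?J p) = form_mult (cst c) (single_form J p)"
        "c * c = 1" using ext_E_single_form[of i ?J j] by metis
      have "single_form J p \<in> K" for p
      proof -
        have "single_form J p = form_mult (cst c) (ext_E j i (single_form ?J p))"
          unfolding c(1) by (simp add: form_mult_def c(2) cst_1 flip: cst_mult)
        moreover have "single_form ?J p \<in> K"
          using \<open>{p. single_form ?J p \<in> K} = UNIV\<close> by blast
        ultimately show ?thesis using form_mult E by metis
      qed
      then show ?thesis by blast
    qed (use UI in simp)
  qed
  have "v \<in> K" if v: "v \<in> ext_power r" for v
  proof -
    have "(\<lambda>J. \<Sum>I\<in>S. single_form I (v I) J) \<in> K" for S
    proof (induction S rule: finite_induct[OF finite])
      case 1 show ?case using z by simp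
    next
      case (2 I S)
      have "single_form I (v I) \<in> K"
      proof (cases "card I = r")
        case True then show ?thesis using all by blast
      next
        case False
        then have "single_form I (v I) = (\<lambda>J. 0)"
          using v by (auto simp: ext_power_def single_form_def)
        then show ?thesis using z by simp
      qed
      from add[OF this 2(3)] show ?case using 2 by (simp add: form_add_def)
    qed
    from this[of UNIV] show ?thesis by (simp add: single_form_def)
  qed
  then show ?thesis using K by blast
qed

section \<open>The images of the differential\<close>

lemma T_rep_simps [simp]:
  "carrier (T_rep sm d r) = ext_power r"
  "\<zero>\<^bsub>T_rep sm d r\<^esub> = (\<lambda>I. 0)"
  "u \<oplus>\<^bsub>T_rep sm d r\<^esub> v = u \<boxplus> v"
  "c \<odot>\<^bsub>T_rep sm d r\<^esub> u = form_mult (cst c) u"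
  "act (T_rep sm d r) = T_act sm d"
  by (simp_all add: T_rep_def form_add_def form_mult_def)

lemma L_rep_simps [simp]:
  "carrier (L_rep sm d r) = L_space d r"
  "\<zero>\<^bsub>L_rep sm d r\<^esub> = (\<lambda>I. 0)"
  "u \<oplus>\<^bsub>L_rep sm d r\<^esub> v = u \<boxplus> v"
  "c \<odot>\<^bsub>L_rep sm d r\<^esub> u = form_mult (cst c) u"
  "act (L_rep sm d r) = T_act sm d"
  by (simp_all add: L_rep_def gn_sub_def T_rep_def form_add_def form_mult_def)

lemma T_module: "gn_module (T_rep sm d r)"
  by (rule T_rep_gn_module) (rule D_module_axioms)

lemma L_space_Suc: "L_space d (Suc r) = T_pi d ` ext_power r"
  by (simp add: L_space_def)

lemma T_pi_epi: "gn_epi (T_pi d) (T_rep sm d r) (L_rep sm d (Suc r))"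
  by (simp add: gn_epi_def L_space_Suc T_pi_0 T_pi_add T_pi_cst T_pi_T_act)

lemma L_module: "gn_module (L_rep sm d (Suc r))"
  by (rule gn_epi_module[OF T_module T_pi_epi])

lemma quot_isomorphic_L:
  "gn_isomorphic (gn_quot (T_rep sm d r) (Lt_space sm d r)) (L_rep sm d (Suc r))"
  using gn_quot_kernel_isomorphic[OF T_module T_pi_epi, of r] by (simp add: Lt_space_eq)

text \<open>
  If \<open>\<pi>\<close> vanished on \<open>r\<close>-forms with \<open>r < n\<close>, then applying it to \<open>q \<otimes> e\<^sub>J\<close> with \<open>i \<notin> J\<close> would give \<open>d\<^sub>i q = 0\<close> for
  all \<open>q \<in> P\<close>, which contradicts \<open>d\<^sub>i x\<^sub>i - x\<^sub>i d\<^sub>i = 1\<close>.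
\<close>

lemma L_space_nonzero:
  assumes nz: "(UNIV :: 'p set) \<noteq> {0}" and r: "r < CARD('n)"
  shows "L_space d (Suc r) \<noteq> {\<lambda>I. 0}"
proof
  assume L: "L_space d (Suc r) = {\<lambda>I. 0}"
  obtain p :: 'p where p: "p \<noteq> 0" using nz by auto
  obtain J :: "'n set" where J: "card J = r"
    using obtain_subset_with_card_n[of r "UNIV :: 'n set"] r by auto
  then obtain i where i: "i \<notin> J" using r by (metis UNIV_eq_I nat_neq_iff)
  have "d i q = 0" for q
  proof -
    let ?u = "single_form J (ext_sign i (insert i J) q)"
    have "?u \<in> ext_power r" using J by (auto simp: ext_power_def single_form_def)
    then have "T_pi d ?u \<in> L_space d (Suc r)" unfolding L_space_Suc by (rule imageI)
    then have "T_pi d ?u (insert i J) = 0" using L by simp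
    moreover have "d k (ext_wedge k ?u (insert i J)) = (if k = i then d i q else 0)" for k
    proof -
      have "insert i J - {k} = J \<longleftrightarrow> k = i" using i by blast
      then show ?thesis by (auto simp: ext_wedge_def single_form_def d_0)
    qed
    ultimately show ?thesis by (simp add: T_pi_eq)
  qed
  then show False using d_Leibniz[of i "xvar i" p] p by (simp add: dA_xvar)
qed

text \<open>
  A submodule \<open>N\<close> is only known to be stable under \<open>\<g>\<^sub>n\<close>.  The gain comes from passing to the forms
  of one degree less: there the preimage of \<open>N\<close> contains a nonzero subspace that is stable
  under \<open>A\<^sub>n\<close> as well, because \<open>\<iota>\<^sub>\<xi> w\<close> depends \<open>A\<^sub>n\<close>-linearly on \<open>\<xi>\<close>.
\<close>

lemma simple_L:
  assumes P: "simple_D_module sm d" and r: "r < CARD('n)"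
  shows "simple_gn_module (L_rep sm d (Suc r))"
  unfolding simple_gn_module_def
proof (intro conjI allI impI)
  show M: "gn_module (L_rep sm d (Suc r))" by (rule L_module)
  show "carrier (L_rep sm d (Suc r)) \<noteq> {\<zero>\<^bsub>L_rep sm d (Suc r)\<^esub>}"
    using L_space_nonzero[OF _ r] P by (simp add: simple_D_module_def)
  fix N assume N: "gn_submodule N (L_rep sm d (Suc r))"
  note D = gn_submoduleD[OF M N, simplified]
  show "N = {\<zero>\<^bsub>L_rep sm d (Suc r)\<^esub>} \<or> N = carrier (L_rep sm d (Suc r))"
  proof (cases "N = {\<lambda>I. 0}")
    case False
    then obtain w where w: "w \<in> N" "w \<noteq> (\<lambda>I. 0)" using D(2) by blast
    \<comment> \<open>the largest \<open>A\<^sub>n\<close>-submodule of the preimage of \<open>N\<close>\<close>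
    define K where "K = {u \<in> ext_power r. \<forall>f. T_pi d (form_mult f u) \<in> N}"
    have m0: "form_mult f (\<lambda>I. 0) = (\<lambda>I. 0)" and ma: "form_mult f (u \<boxplus> v) = form_mult f u \<boxplus> form_mult f v"
      and mm: "form_mult f (form_mult g u) = form_mult (f * g) u" for f g u v
      by (auto simp: form_mult_def form_add_def scale_right_distrib)
    have "K = ext_power r"
    proof (rule A_stable_g_submodule[OF P])
      show "K \<subseteq> ext_power r" by (auto simp: K_def)
      show "(\<lambda>I. 0) \<in> K" using D(2) by (simp add: K_def m0 T_pi_0 ext_power_def)
      show "u \<boxplus> v \<in> K" if "u \<in> K" "v \<in> K" for u v
        using that D(3) by (auto simp: K_def ma T_pi_add) (simp add: ext_power_def form_add_def)
      show "form_mult f u \<in> K" if "u \<in> K" for f u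
        using that by (auto simp: K_def mm) (simp add: ext_power_def form_mult_def)
      show "T_act sm d \<xi> u \<in> K" if u: "u \<in> K" for \<xi> u
      proof -
        have "T_pi d (form_mult f (T_act sm d \<xi> u)) \<in> N" for f
        proof -
          \<comment> \<open>\<open>f (\<xi> u) = \<xi> (f u) - \<xi>(f) u\<close>\<close>
          have e: "form_mult f (T_act sm d \<xi> u) =
              T_act sm d \<xi> (form_mult f u) \<boxplus> form_mult (- gn_derivation \<xi> f) u"
            by (simp add: T_act_mult) (simp add: form_add_def form_mult_def)
          show ?thesis unfolding e T_pi_add T_pi_T_act
            using u by (intro D(3) D(6)) (simp_all add: K_def)
        qed
        then show ?thesis using u T_act_power by (simp add: K_def)
      qed
      have "w \<in> ext_power (Suc r)" using D(1) w T_pi_power by (auto simp: L_space_Suc)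
      have "\<exists>j. ext_contract j w \<noteq> (\<lambda>I. 0)"
      proof -
        obtain I where I: "w I \<noteq> 0" using w by blast
        then have "I \<noteq> {}" using \<open>w \<in> ext_power (Suc r)\<close> by (auto simp: ext_power_def)
        then obtain j where "j \<in> I" by blast
        then have "ext_E j j w I \<noteq> 0" using I by (simp add: ext_E_diag)
        then have "ext_contract j w \<noteq> (\<lambda>I. 0)"
          by (auto simp: ext_E_def ext_wedge_0)
        then show ?thesis by blast
      qed
      then obtain j where j: "ext_contract j w \<noteq> (\<lambda>I. 0)" by blast
      have "ext_contract j w \<in> K"
      proof -
        obtain v where v: "w = T_pi d v" using D(1) w by (auto simp: L_space_Suc)
        \<comment> \<open>The \<open>A\<^sub>n\<close>-multiples of the contraction of \<open>w\<close> with \<open>d\<^sub>j\<close> are the contractions with \<open>f d\<^sub>j\<close>, and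
          \<open>\<pi>\<close> maps these to \<open>(f d\<^sub>j) w\<close> because \<open>w\<close> is closed.\<close>
        have "form_mult f (ext_contract j w) = iota (coord j f) w" for f
        proof
          fix I
          have "iota (coord j f) w I = (\<Sum>k\<in>UNIV. if k = j then sm f (ext_contract j w I) else 0)"
            unfolding iota_def by (intro sum.cong refl) simp
          then show "form_mult f (ext_contract j w) I = iota (coord j f) w I"
            by (simp add: form_mult_def)
        qed
        then have "T_pi d (form_mult f (ext_contract j w)) = T_act sm d (coord j f) w" for f
          unfolding v by (simp add: T_act_T_pi)
        then show ?thesis
          using D(6)[OF w(1)] ext_contract_power[OF \<open>w \<in> ext_power (Suc r)\<close>] by (simp add: K_def)
      qed
      then show "K \<noteq> {\<lambda>I. 0}" using j by blast
    qed
    then have "T_pi d (form_mult 1 u) \<in> N" if "u \<in> ext_power r" for u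
      using that by (auto simp: K_def)
    then have "L_space d (Suc r) \<subseteq> N" by (auto simp: L_space_Suc form_mult_def)
    then show ?thesis using D(1) by auto
  qed simp
qed

lemma simple_quot:
  assumes "simple_D_module sm d" and "r < CARD('n)"
  shows "simple_gn_module (gn_quot (T_rep sm d r) (Lt_space sm d r))"
  by (rule simple_gn_module_isomorphic[OF quot_isomorphic_L simple_L[OF assms]])

section \<open>The two ends of the complex\<close>

lemma ext_power_0: "u \<in> ext_power 0 \<longleftrightarrow> u = single_form {} (u {})"
  by (auto simp: ext_power_def single_form_def fun_eq_iff)

lemma single_form_same [simp]: "single_form I p I = p"
  by (simp add: single_form_def)

lemma single_form_power: "card I = r \<Longrightarrow> single_form I p \<in> ext_power r"
  by (auto simp: ext_power_def single_form_def)

lemma T_pi_ext_power_0: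
  assumes "u \<in> ext_power 0"
  shows "T_pi d u = (\<lambda>I. 0) \<longleftrightarrow> (\<forall>i. d i (u {}) = 0)"
proof -
  have s: "T_pi d u {i} = d i (u {})" for i
  proof -
    have e: "{k. k = i \<and> k < i} = {}" by auto
    have "d k (ext_wedge k u {i}) = (if k = i then d i (u {}) else 0)" for k
      by (auto simp: ext_wedge_def ext_sign_def d_0 e)
    then show ?thesis by (simp add: T_pi_eq)
  qed
  have "T_pi d u I = 0" if "\<And>i. I \<noteq> {i}" for I
    using T_pi_power[OF assms] that card_1_singletonE[of I] by (auto simp: ext_power_def)
  then show ?thesis using s unfolding fun_eq_iff by metis
qed

text \<open>
  The kernel of \<open>\<pi>\<close> on \<open>P\<close> consists of the elements killed by all \<open>d\<^sub>i\<close>.  If it is zero, then \<open>P\<close> is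
  isomorphic to the simple module \<open>L(P, 1)\<close>.  Otherwise a nonzero element \<open>p\<close> of it gives the
  homomorphism \<open>f \<mapsto> f p\<close> of \<open>D\<^sub>n\<close>-modules from \<open>A\<^sub>n\<close> to \<open>P\<close>, which is bijective since both modules are simple;
  and \<open>1 \<in> A\<^sub>n\<close> shows that the kernel is nonzero for \<open>P \<cong> A\<^sub>n\<close>.
\<close>

lemma simple_T_0_iff:
  assumes P: "simple_D_module sm d"
  shows "simple_gn_module (T_rep sm d 0) \<longleftrightarrow> \<not> D_isomorphic sm d (*) dA"
proof
  have nz: "(UNIV :: 'p set) \<noteq> {0}" using P by (simp add: simple_D_module_def)
  have n: "0 < CARD('n)" by simp
  assume S: "simple_gn_module (T_rep sm d 0)"
  show "\<not> D_isomorphic sm d (*) dA"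
  proof
    assume "D_isomorphic sm d (*) (dA :: 'n \<Rightarrow> _)"
    then obtain \<phi> :: "'p \<Rightarrow> 'n An" where b: "bij \<phi>" and a: "\<And>p q. \<phi> (p + q) = \<phi> p + \<phi> q"
      and h: "\<And>i p. \<phi> (d i p) = dA i (\<phi> p)"
      unfolding D_isomorphic_def by blast
    have 0: "\<phi> 0 = 0" using a[of 0 0] by simp
    obtain p where p: "\<phi> p = 1" using b by (metis bij_pointE)
    have "p \<noteq> 0" using p 0 by auto
    have "\<phi> (d i p) = \<phi> 0" for i by (simp add: h p 0 dA_1)
    then have "d i p = 0" for i using b by (meson bij_is_inj injD)
    then have "single_form {} p \<in> {u \<in> ext_power 0. T_pi d u = (\<lambda>I. 0)}"
      by (simp add: single_form_power T_pi_ext_power_0)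
    moreover have "single_form {} p \<noteq> (\<lambda>I. 0)"
      using \<open>p \<noteq> 0\<close> by (auto simp: single_form_def fun_eq_iff)
    moreover have "{u \<in> ext_power 0. T_pi d u = (\<lambda>I. 0)} = {\<lambda>I. 0} \<or>
        {u \<in> ext_power 0. T_pi d u = (\<lambda>I. 0)} = ext_power 0"
      using gn_epi_kernel[OF T_module T_pi_epi, of 0] S by (simp add: simple_gn_module_def)
    ultimately have "{u \<in> ext_power 0. T_pi d u = (\<lambda>I. 0)} = ext_power 0" by blast
    then have "L_space d (Suc 0) \<subseteq> {\<lambda>I. 0}" by (auto simp: L_space_Suc)
    moreover have "(\<lambda>I. 0) \<in> L_space d (Suc 0)"
      using gn_submoduleD(2) L_module T_pi_0 by (force simp: L_space_Suc ext_power_def)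
    ultimately show False using L_space_nonzero[OF nz n] by blast
  qed
next
  assume niso: "\<not> D_isomorphic sm d (*) (dA :: 'n \<Rightarrow> _)"
  have "p = 0" if p: "\<And>i. d i p = 0" for p
  proof (rule ccontr)
    assume "p \<noteq> 0"
    interpret A: D_module "(*)" "dA :: 'n \<Rightarrow> 'n An \<Rightarrow> 'n An" by (rule D_module_An)
    have "D_submodule (*) dA {f. sm f p = 0}"
      unfolding D_submodule_def A.subspace_def
    proof (auto simp: scale_left_distrib simp flip: scale_scale)
      fix i f assume "sm f p = 0"
      then show "sm (dA i f) p = 0" using d_Leibniz[of i f p] by (simp add: p d_0)
    qed
    moreover have "1 \<notin> {f. sm f p = 0}" using \<open>p \<noteq> 0\<close> by simp
    ultimately have k: "{f. sm f p = 0} = {0}"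
      using simple_An unfolding simple_D_module_def by blast
    have "D_submodule sm d (range (\<lambda>f. sm f p))"
      unfolding D_submodule_def subspace_def
    proof (intro conjI ballI allI)
      show "0 \<in> range (\<lambda>f. sm f p)" by (rule range_eqI[of _ _ 0]) simp
      show "x + y \<in> range (\<lambda>f. sm f p)"
        if "x \<in> range (\<lambda>f. sm f p)" "y \<in> range (\<lambda>f. sm f p)" for x y
        using that by (auto simp flip: scale_left_distrib)
      show "sm g x \<in> range (\<lambda>f. sm f p)" if "x \<in> range (\<lambda>f. sm f p)" for g x
        using that by auto
      show "d i x \<in> range (\<lambda>f. sm f p)" if "x \<in> range (\<lambda>f. sm f p)" for i x
        using that by (auto simp: d_sm p)
    qed
    moreover have "p \<in> range (\<lambda>f. sm f p)" by (rule range_eqI[of _ _ 1]) simp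
    ultimately have surj: "surj (\<lambda>f. sm f p)"
      using P \<open>p \<noteq> 0\<close> unfolding simple_D_module_def by blast
    have "inj (\<lambda>f. sm f p)"
    proof (rule injI)
      fix f g assume "sm f p = sm g p"
      then have "f - g \<in> {f. sm f p = 0}" by (simp add: scale_left_diff_distrib)
      then show "f = g" unfolding k by simp
    qed
    with surj have b: "bij (\<lambda>f. sm f p)" by (simp add: bij_def)
    let ?\<phi> = "inv_into UNIV (\<lambda>f. sm f p)"
    have \<phi>: "sm (?\<phi> q) p = q" for q using surj_f_inv_f[OF surj, of q] .
    have \<phi>': "?\<phi> (sm f p) = f" for f using inv_f_f[OF \<open>inj (\<lambda>f. sm f p)\<close>, of f] .
    have "D_isomorphic sm d (*) dA"
      unfolding D_isomorphic_def
    proof (intro exI[of _ ?\<phi>] conjI allI)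
      show "bij ?\<phi>" using b by (rule bij_imp_bij_inv)
      show "?\<phi> (q + r) = ?\<phi> q + ?\<phi> r" for q r
        using \<phi>'[of "?\<phi> q + ?\<phi> r"] by (simp add: scale_left_distrib \<phi>)
      show "?\<phi> (sm f q) = f * ?\<phi> q" for f q
        using \<phi>'[of "f * ?\<phi> q"] by (simp add: \<phi> flip: scale_scale)
      show "?\<phi> (d i q) = dA i (?\<phi> q)" for i q
        using \<phi>'[of "dA i (?\<phi> q)"] d_sm[of i "?\<phi> q" p] by (simp add: \<phi> p)
    qed
    then show False using niso by blast
  qed
  note no_horizontal = this
  have "u = (\<lambda>I. 0)" if u: "u \<in> ext_power 0" "T_pi d u = (\<lambda>I. 0)" for u
  proof
    fix I
    have "u {} = 0" using no_horizontal u T_pi_ext_power_0 by blast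
    then show "u I = 0" using u(1) by (cases "I = {}") (auto simp: ext_power_def)
  qed
  then have "gn_isomorphic (T_rep sm d 0) (L_rep sm d (Suc 0))"
    by (intro gn_epi_isomorphic[OF T_module T_pi_epi]) auto
  then show "simple_gn_module (T_rep sm d 0)"
    by (rule simple_gn_module_isomorphic) (rule simple_L[OF P], simp)
qed

lemma L_space_submodule: "gn_submodule (L_space d (Suc r)) (T_rep sm d (Suc r))"
proof (rule gn_submoduleI[OF T_module], simp_all add: L_space_Suc)
  show "T_pi d ` ext_power r \<subseteq> ext_power (Suc r)" using T_pi_power by blast
  show "(\<lambda>I. 0) \<in> T_pi d ` ext_power r"
    by (rule image_eqI[of _ _ "\<lambda>I. 0"]) (simp_all add: T_pi_0 ext_power_def)
  show "u \<boxplus> v \<in> T_pi d ` ext_power r" if "u \<in> T_pi d ` ext_power r" "v \<in> T_pi d ` ext_power r" for u v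
  proof -
    have "u' \<boxplus> v' \<in> ext_power r" if "u' \<in> ext_power r" "v' \<in> ext_power r" for u' v'
      using that by (simp add: ext_power_def form_add_def)
    then show ?thesis using that by (auto simp flip: T_pi_add)
  qed
  show "form_mult (cst c) u \<in> T_pi d ` ext_power r" if "u \<in> T_pi d ` ext_power r" for c u
  proof -
    have "form_mult f u' \<in> ext_power r" if "u' \<in> ext_power r" for u' f
      using that by (simp add: ext_power_def form_mult_def)
    then show ?thesis using that by (auto simp flip: T_pi_cst)
  qed
  show "T_act sm d \<xi> u \<in> T_pi d ` ext_power r" if "u \<in> T_pi d ` ext_power r" for \<xi> u
    using that T_act_power by (auto simp flip: T_pi_T_act)
qed

text \<open>
  A form of degree \<open>n\<close> is its component at the full index set, and the components of a form of degree
  \<open>n - 1\<close> at the complements of the single indices can be prescribed independently.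
\<close>

lemma L_space_top:
  assumes n: "CARD('n) = Suc m"
  shows "L_space d (Suc m) = {w \<in> ext_power (Suc m). w UNIV \<in> {\<Sum>i\<in>UNIV. d i (p i) | p. True}}"
proof (intro equalityI subsetI)
  fix w assume "w \<in> L_space d (Suc m)"
  then obtain u where u: "u \<in> ext_power m" "w = T_pi d u" by (auto simp: L_space_Suc)
  then show "w \<in> {w \<in> ext_power (Suc m). w UNIV \<in> {\<Sum>i\<in>UNIV. d i (p i) | p. True}}"
    using T_pi_power[of u m] by (auto simp: T_pi_eq)
next
  fix w :: "'n set \<Rightarrow> 'p" assume "w \<in> {w \<in> ext_power (Suc m). w UNIV \<in> {\<Sum>i\<in>UNIV. d i (p i) | p. True}}"
  then obtain p where w: "w \<in> ext_power (Suc m)" "w UNIV = (\<Sum>i\<in>UNIV. d i (p i))" by auto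
  \<comment> \<open>The signs compensate those of \<open>e\<^sub>i \<and> e\<^sub>J\<close> for \<open>J = UNIV - {i}\<close>.\<close>
  define u where "u I = (\<Sum>i\<in>UNIV. if I = UNIV - {i} then ext_sign i UNIV (p i) else 0)" for I
  have u: "u \<in> ext_power m"
    unfolding ext_power_def
  proof (intro CollectI allI impI)
    fix I :: "'n set" assume "card I \<noteq> m"
    then have "I \<noteq> UNIV - {i}" for i using n by auto
    then show "u I = 0" by (simp add: u_def)
  qed
  have "u (UNIV - {i}) = ext_sign i UNIV (p i)" for i
  proof -
    have "UNIV - {i} = UNIV - {k} \<longleftrightarrow> i = k" for k by blast
    then show ?thesis by (simp add: u_def)
  qed
  then have "T_pi d u UNIV = w UNIV" by (simp add: T_pi_eq ext_wedge_def w)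
  moreover have "T_pi d u I = w I" if "I \<noteq> UNIV" for I
  proof -
    have "card I \<noteq> Suc m" using that n card_subset_eq[of UNIV I] by auto
    then show ?thesis using T_pi_power[OF u] w by (simp add: ext_power_def)
  qed
  ultimately have "T_pi d u = w" by (intro ext) metis
  then show "w \<in> L_space d (Suc m)" using u by (auto simp: L_space_Suc)
qed

lemma simple_T_top_iff:
  assumes P: "simple_D_module sm d"
  shows "simple_gn_module (T_rep sm d CARD('n)) \<longleftrightarrow> {\<Sum>i\<in>UNIV. d i (p i) | p. True} = UNIV"
proof -
  obtain m where n: "CARD('n) = Suc m" using not0_implies_Suc[of "CARD('n)"] by auto
  let ?S = "{\<Sum>i\<in>UNIV. d i (p i) | p. True}"
  have eq: "L_space d (Suc m) = ext_power (Suc m) \<longleftrightarrow> ?S = UNIV"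
  proof
    assume L: "L_space d (Suc m) = ext_power (Suc m)"
    have "q \<in> ?S" for q
    proof -
      have "single_form UNIV q \<in> L_space d (Suc m)"
        unfolding L using n by (auto simp: ext_power_def single_form_def)
      then show ?thesis unfolding L_space_top[OF n] by (simp add: single_form_def)
    qed
    then show "?S = UNIV" by blast
  qed (simp add: L_space_top[OF n])
  have "simple_gn_module (T_rep sm d (Suc m)) \<longleftrightarrow> L_space d (Suc m) = ext_power (Suc m)"
  proof
    assume "simple_gn_module (T_rep sm d (Suc m))"
    then have "L_space d (Suc m) = {\<lambda>I. 0} \<or> L_space d (Suc m) = ext_power (Suc m)"
      using L_space_submodule[of m] by (simp add: simple_gn_module_def)
    then show "L_space d (Suc m) = ext_power (Suc m)"
      using L_space_nonzero[of m] P n by (simp add: simple_D_module_def)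
  next
    assume "L_space d (Suc m) = ext_power (Suc m)"
    then have "L_rep sm d (Suc m) = T_rep sm d (Suc m)"
      by (simp add: L_rep_def gn_sub_def T_rep_def)
    then show "simple_gn_module (T_rep sm d (Suc m))" using simple_L[OF P, of m] n by simp
  qed
  then show ?thesis using eq n by simp
qed

lemma trivial_T_top_quot: "trivial_gn_module (gn_quot (T_rep sm d CARD('n)) (L_space d CARD('n)))"
proof -
  obtain m where n: "CARD('n) = Suc m" using not0_implies_Suc[of "CARD('n)"] by auto
  have "T_act sm d \<xi> u \<in> L_space d (Suc m)" if u: "u \<in> ext_power (Suc m)" for \<xi> u
  proof -
    have "card I \<noteq> Suc (Suc m)" for I :: "'n set"
      using card_mono[of UNIV I] n by auto
    then have "T_pi d u = (\<lambda>I. 0)" using T_pi_power[OF u] by (simp add: ext_power_def fun_eq_iff)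
    then show ?thesis
      using iota_power[OF u] by (simp add: Cartan_formula iota_0 L_space_Suc)
  qed
  then show ?thesis unfolding n
    by (intro trivial_gn_quotI T_module L_space_submodule) simp
qed

end

text \<open>
  \<open>A\<^sub>n\<close> is \<open>T(A\<^sub>n, V(\<delta>\<^sub>0, 0))\<close> in a different encoding: a function corresponds to the \<open>0\<close>-form with that
  value at the empty index.
\<close>

lemma simple_An_quot:
  "simple_gn_module (gn_quot (An_rep :: ('n::{finite,linorder}, 'n An) gn_rep) (range cst))"
proof -
  interpret D_forms "(*)" "dA :: 'n \<Rightarrow> 'n An \<Rightarrow> 'n An"
    by (rule D_forms.intro) (rule D_module_An)
  let ?A = "An_rep :: ('n, 'n An) gn_rep"
  have E: "ext_E i j u {} = 0" for i j and u :: "'n set \<Rightarrow> 'n An"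
    by (simp add: ext_E_def ext_wedge_def)
  have ac: "T_act (*) dA \<xi> u {} = gn_derivation \<xi> (u {})" for \<xi> and u :: "'n set \<Rightarrow> 'n An"
    by (simp add: T_act_def E gn_derivation_def)
  have "gn_epi (\<lambda>u :: 'n set \<Rightarrow> 'n An. u {}) (T_rep (*) (dA :: 'n \<Rightarrow> _) 0) ?A"
  proof -
    have "f \<in> (\<lambda>u :: 'n set \<Rightarrow> 'n An. u {}) ` ext_power 0" for f :: "'n An"
      by (rule image_eqI[of _ _ "single_form {} f"]) (auto simp: single_form_def ext_power_def)
    then show ?thesis by (auto simp: gn_epi_def An_rep_def form_add_def form_mult_def ac)
  qed
  then have A: "gn_module ?A" by (rule gn_epi_module[OF T_module])
  define \<psi> where "\<psi> f = T_pi dA (single_form {} f)" for f :: "'n An"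
  have sp: "single_form {} f \<in> ext_power 0" for f :: "'n An"
    by (simp add: single_form_power)
  have sa: "single_form {} (gn_derivation \<xi> f) = T_act (*) dA \<xi> (single_form {} f)" for \<xi> f
    using T_act_power[OF sp, of \<xi> f] ext_power_0 by (metis ac single_form_def)
  have "gn_epi \<psi> ?A (L_rep (*) (dA :: 'n \<Rightarrow> _) (Suc 0))"
    unfolding gn_epi_def
  proof (intro conjI ballI allI)
    have "range (\<lambda>f :: 'n An. single_form {} f) = ext_power 0" using sp ext_power_0 by blast
    then have "range \<psi> = T_pi dA ` ext_power 0" unfolding \<psi>_def by (metis image_image)
    then show "\<psi> ` carrier ?A = carrier (L_rep (*) dA (Suc 0))"
      by (simp add: An_rep_def L_space_Suc)
    have "single_form {} 0 = (\<lambda>I. 0)" by (auto simp: single_form_def)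
    then show "\<psi> \<zero>\<^bsub>?A\<^esub> = \<zero>\<^bsub>L_rep (*) dA (Suc 0)\<^esub>"
      by (simp add: \<psi>_def An_rep_def T_pi_0)
    fix f g :: "'n An" and c \<xi>
    have "single_form {} (f + g) = single_form {} f \<boxplus> single_form {} g"
      by (auto simp: single_form_def form_add_def)
    then show "\<psi> (f \<oplus>\<^bsub>?A\<^esub> g) = \<psi> f \<oplus>\<^bsub>L_rep (*) dA (Suc 0)\<^esub> \<psi> g"
      by (simp add: \<psi>_def An_rep_def T_pi_add)
    have "single_form {} (cst c * f) = form_mult (cst c) (single_form {} f)"
      by (auto simp: single_form_def form_mult_def)
    then show "\<psi> (c \<odot>\<^bsub>?A\<^esub> f) = c \<odot>\<^bsub>L_rep (*) dA (Suc 0)\<^esub> \<psi> f"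
      by (simp add: \<psi>_def An_rep_def T_pi_cst)
    show "\<psi> (act ?A \<xi> f) = act (L_rep (*) dA (Suc 0)) \<xi> (\<psi> f)"
      by (simp add: \<psi>_def An_rep_def sa T_pi_T_act)
  qed
  note iso = gn_quot_kernel_isomorphic[OF A this]
  have "{f \<in> carrier ?A. \<psi> f = \<zero>\<^bsub>L_rep (*) (dA :: 'n \<Rightarrow> _) (Suc 0)\<^esub>} = {f. \<forall>i. dA i f = 0}"
    by (simp add: An_rep_def \<psi>_def T_pi_ext_power_0[OF sp])
  also have "\<dots> = range cst"
  proof (intro equalityI subsetI)
    fix f :: "'n An" assume "f \<in> {f. \<forall>i. dA i f = 0}"
    then have "f = cst (cf f 0)" by (intro constant_if_dA_0) simp
    then show "f \<in> range cst" by (rule range_eqI)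
  qed (auto simp: dA_cst)
  finally have "gn_isomorphic (gn_quot ?A (range cst)) (L_rep (*) (dA :: 'n \<Rightarrow> _) (Suc 0))"
    using iso by simp
  then show ?thesis
    by (rule simple_gn_module_isomorphic) (rule simple_L[OF simple_An], simp)
qed

theorem theorem3p7:
  fixes sm :: "'n::{finite,linorder} An \<Rightarrow> 'p::ab_group_add \<Rightarrow> 'p"
    and d :: "'n \<Rightarrow> 'p \<Rightarrow> 'p"
  assumes P: "simple_D_module sm d"
  shows
    "(\<forall>r<CARD('n). simple_gn_module (gn_quot (T_rep sm d r) (Lt_space sm d r)))
   \<and> (\<forall>r\<in>{1..CARD('n)}. simple_gn_module (L_rep sm d r) \<and>
        gn_isomorphic (gn_quot (T_rep sm d (r - 1)) (Lt_space sm d (r - 1))) (L_rep sm d r))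
   \<and> (simple_gn_module (T_rep sm d 0) \<longleftrightarrow> \<not> D_isomorphic sm d (*) dA)
   \<and> simple_gn_module (gn_quot (An_rep :: ('n, 'n An) gn_rep) (range cst))
   \<and> (simple_gn_module (T_rep sm d CARD('n)) \<longleftrightarrow> {\<Sum>i\<in>UNIV. d i (p i) | p. True} = UNIV)
   \<and> (\<not> simple_gn_module (T_rep sm d CARD('n)) \<longrightarrow>
        trivial_gn_module (gn_quot (T_rep sm d CARD('n)) (L_space d CARD('n))))"
proof -
  interpret D_forms sm d
    by (rule D_forms.intro) (use P in \<open>simp add: simple_D_module_def\<close>)
  have "simple_gn_module (L_rep sm d r) \<and>
        gn_isomorphic (gn_quot (T_rep sm d (r - 1)) (Lt_space sm d (r - 1))) (L_rep sm d r)"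
    if r: "r \<in> {1..CARD('n)}" for r
  proof -
    have "r - 1 < CARD('n)" "Suc (r - 1) = r" using r by auto
    then show ?thesis using simple_L[OF P, of "r - 1"] quot_isomorphic_L[of "r - 1"] by simp
  qed
  then show ?thesis
    by (intro conjI allI ballI impI simple_quot[OF P] simple_T_0_iff[OF P] simple_An_quot
        simple_T_top_iff[OF P] trivial_T_top_quot) auto
qed

end
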